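(* Let $M$ and $N$ be matroids on a common countable edge set $E$ such that each of them is either finitary or cofinitary. Then $M$ and $N$ have a common base if and only if both $\mathsf{cond}(M,N)$ and $\mathsf{cond}(N,M)$ hold.
   Context: A (possibly infinite) matroid is a pair $M=(E,\mathcal I)$ with $\mathcal I\subseteq\mathcal P(E)$ such that: (1) $\varnothing\in\mathcal I$; (2) $\mathcal I$ is downward closed; (3) for all $I,J\in\mathcal I$ where $J$ is $\subseteq$-maximal in $\mathcal I$ but $I$ is not, there is $e\in J\setminus I$ with $I+e:=I\cup\{e\}\in\mathcal I$; (4) for every $X\subseteq E$, any $I\in\mathcal I\cap\mathcal P(X)$ can be extended to a $\subseteq$-maximal element of $\mathcal I\cap\mathcal P(X)$. Members of $\mathcal I$ are independent, maximal independent sets are bases, minimal dependent sets are circuits. The dual $M^*$ is the matroid on $E$ whose bases are the complements of the bases of $M$. The restriction is $M\upharpoonright X:=(X,\mathcal I\cap\mathcal P(X))$, deletion is $M-X:=M\upharpoonright(E\setminus X)$, contraction is $M/X:=(M^*-X)^*$, and the contraction onto $X$ is $M.X:=M/(E\setminus X)$ (a matroid on $X$). $\mathsf{cond}(M,N)$ is the condition: for every $W\subseteq E$ for which there is a base of $M\upharpoonright W$ that is independent in $N.W$, there exists a base of $N.W$ which is independent in $M\upharpoonright W$. A matroid is finitary if all of its circuits are finite, and cofinitary if its dual is finitary. *)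

theory Defs
  imports "HOL-Library.Countable_Set"
begin

text \<open>Possibly infinite matroids in the sense of Bruhn, Diestel, Kriesell, Pendavingh and Wollan,
  given by a ground set and a family of independent sets.\<close>

type_synonym 'a matroid = "'a set \<times> 'a set set"

abbreviation ground :: "'a matroid \<Rightarrow> 'a set" where
  "ground \<equiv> fst"

abbreviation indep :: "'a matroid \<Rightarrow> 'a set set" where
  "indep \<equiv> snd"

definition maximal_in :: "'a set set \<Rightarrow> 'a set \<Rightarrow> bool" where
  "maximal_in F X \<longleftrightarrow> X \<in> F \<and> (\<forall>Y\<in>F. X \<subseteq> Y \<longrightarrow> Y = X)"

definition minimal_in :: "'a set set \<Rightarrow> 'a set \<Rightarrow> bool" where
  "minimal_in F X \<longleftrightarrow> X \<in> F \<and> (\<forall>Y\<in>F. Y \<subseteq> X \<longrightarrow> Y = X)"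

definition matroid :: "'a matroid \<Rightarrow> bool" where
  "matroid M \<longleftrightarrow>
     indep M \<subseteq> Pow (ground M) \<and>
     {} \<in> indep M \<and>
     (\<forall>J\<in>indep M. \<forall>I. I \<subseteq> J \<longrightarrow> I \<in> indep M) \<and>
     (\<forall>I\<in>indep M. \<forall>J\<in>indep M.
        maximal_in (indep M) J \<and> \<not> maximal_in (indep M) I \<longrightarrow>
        (\<exists>e\<in>J - I. insert e I \<in> indep M)) \<and>
     (\<forall>X. X \<subseteq> ground M \<longrightarrow>
        (\<forall>I\<in>indep M \<inter> Pow X. \<exists>J. I \<subseteq> J \<and> maximal_in (indep M \<inter> Pow X) J))"

definition base :: "'a matroid \<Rightarrow> 'a set \<Rightarrow> bool" where
  "base M B \<longleftrightarrow> maximal_in (indep M) B"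

definition circuit :: "'a matroid \<Rightarrow> 'a set \<Rightarrow> bool" where
  "circuit M C \<longleftrightarrow> minimal_in (Pow (ground M) - indep M) C"

text \<open>The independent sets of a matroid are exactly the subsets of its bases, so prescribing the
  bases of the dual determines it; \<open>base_dual\<close> confirms that they are the prescribed ones.\<close>

definition dual :: "'a matroid \<Rightarrow> 'a matroid" where
  "dual M = (ground M, {I. \<exists>B. base M B \<and> I \<subseteq> ground M - B})"

lemma base_dual:
  assumes "matroid M"
  shows "base (dual M) D \<longleftrightarrow> (\<exists>B. base M B \<and> D = ground M - B)"
proof -
  have sub: "B \<subseteq> ground M" if "base M B" for B
  proof -
    have "B \<in> indep M" using that by (simp add: base_def maximal_in_def)
    moreover have "indep M \<subseteq> Pow (ground M)" using assms by (simp add: matroid_def)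
    ultimately show ?thesis by auto
  qed
  have anti: "B = B'" if "base M B" "base M B'" "B' \<subseteq> B" for B B'
    using that by (simp add: base_def maximal_in_def)
  have ind: "I \<in> indep (dual M) \<longleftrightarrow> (\<exists>B. base M B \<and> I \<subseteq> ground M - B)" for I
    by (simp add: dual_def)
  have bas: "base (dual M) D \<longleftrightarrow>
      D \<in> indep (dual M) \<and> (\<forall>Y. Y \<in> indep (dual M) \<longrightarrow> D \<subseteq> Y \<longrightarrow> Y = D)"
    by (simp add: base_def maximal_in_def Ball_def)
  show ?thesis
  proof
    assume D: "base (dual M) D"
    then obtain B where B: "base M B" "D \<subseteq> ground M - B"
      using bas ind by metis
    then have "ground M - B \<in> indep (dual M)"
      using ind by blast
    then have "D = ground M - B"
      using D B(2) bas by metis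
    then show "\<exists>B. base M B \<and> D = ground M - B"
      using B(1) by metis
  next
    assume "\<exists>B. base M B \<and> D = ground M - B"
    then obtain B where B: "base M B" and D: "D = ground M - B" by metis
    have "Y = D" if Y: "Y \<in> indep (dual M)" "D \<subseteq> Y" for Y
    proof -
      obtain B' where B': "base M B'" "Y \<subseteq> ground M - B'"
        using Y(1) ind by metis
      have "B' \<subseteq> B" using D Y(2) B'(2) sub[OF B'(1)] by auto
      then have "B = B'" using anti B B'(1) by metis
      then show ?thesis using B'(2) D Y(2) by simp
    qed
    moreover have "D \<in> indep (dual M)"
      using B D ind by blast
    ultimately show "base (dual M) D"
      using bas by metis
  qed
qed

definition restrict_to :: "'a matroid \<Rightarrow> 'a set \<Rightarrow> 'a matroid" where
  "restrict_to M X = (X, indep M \<inter> Pow X)"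

definition delete :: "'a matroid \<Rightarrow> 'a set \<Rightarrow> 'a matroid" where
  "delete M X = restrict_to M (ground M - X)"

definition contract :: "'a matroid \<Rightarrow> 'a set \<Rightarrow> 'a matroid" where
  "contract M X = dual (delete (dual M) X)"

definition contract_onto :: "'a matroid \<Rightarrow> 'a set \<Rightarrow> 'a matroid" where
  "contract_onto M X = contract M (ground M - X)"

definition finitary :: "'a matroid \<Rightarrow> bool" where
  "finitary M \<longleftrightarrow> (\<forall>C. circuit M C \<longrightarrow> finite C)"

definition cofinitary :: "'a matroid \<Rightarrow> bool" where
  "cofinitary M \<longleftrightarrow> finitary (dual M)"

text \<open>The condition is only meant for matroids on a common ground set.\<close>

definition matroid_cond :: "'a matroid \<Rightarrow> 'a matroid \<Rightarrow> bool" where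
  "matroid_cond M N \<longleftrightarrow>
     (\<forall>W. W \<subseteq> ground M \<longrightarrow>
        (\<exists>B. base (restrict_to M W) B \<and> B \<in> indep (contract_onto N W)) \<longrightarrow>
        (\<exists>B. base (contract_onto N W) B \<and> B \<in> indep (restrict_to M W)))"

end

theory Submission
  imports Defs
begin

text \<open>Call \<open>W\<close> a wave if some subset of \<open>W\<close> that spans \<open>W\<close> in \<open>M\<close> is independent in \<open>N.W\<close>. There
  is a largest wave, and \<open>cond(M, N)\<close> allows us to contract and delete its elements, after which no
  nonempty wave is left. In this situation every element can be decided (contracted or
  deleted) so that again no nonempty wave remains. If \<open>N\<close> is finitary, any given element can moreover
  be \<open>N\<close>-spanned by contracted elements: augment along alternating paths by priority; if some
  elements were never captured, the sets of elements that they reach would form a nontrivial wave in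
  the limit. Absence of waves is preserved by passing from \<open>(M, N)\<close> to \<open>(N*, M*)\<close>, so for cofinitary
  \<open>M\<close> any element can be \<open>M*\<close>-spanned by deleted elements. Iterating over the countable ground set
  yields an \<open>M\<close>-independent \<open>N\<close>-spanning set, and by symmetry an \<open>N\<close>-independent \<open>M\<close>-spanning set.
  A Cantor-Bernstein argument, a matroid kernel obtained from the Knaster-Tarski theorem, merges the
  two into a common base.\<close>

section \<open>Matroids as closure operators\<close>

text \<open>The difficulty is that limits are one-sided. For a finitary operator an increasing union
  of independent sets is independent, but it spans only what some stage already spans. So
  independence of the contracted elements in \<open>M\<close> is inherited by the limit if
  \<open>M\<close> is finitary, and their spanning in \<open>N\<close> is inherited if
  \<open>N\<close> is cofinitary, being independence of the deleted elements in the dual of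
  \<open>N\<close>. Only in the other cases must elements be captured one at a time. This is why
  contracted and deleted elements are tracked together and why all four combinations run through one
  iteration. Capturing is delicate because successive augmentations exchange elements, so that the
  sets need not converge; only their spans in \<open>N\<close> grow. The limit object serves solely
  to show that everything is captured eventually, and the set that is used comes from a finite
  stage. Each of the two conditions yields a set of its own. These sets need not be related, hence
  the final merging.\<close>

text \<open>Closure operators act on all sets of the type, so that no carrier sets are needed: elements
  outside the ground set, and elements that were contracted or deleted, are loops. In \<open>cl_dual\<close> the elements outside the ground set become coloops.\<close>

definition cl_indep :: "('a set \<Rightarrow> 'a set) \<Rightarrow> 'a set \<Rightarrow> bool" where
  "cl_indep c I \<longleftrightarrow> (\<forall>x\<in>I. x \<notin> c (I - {x}))"

locale closure_matroid =
  fixes c :: "'a set \<Rightarrow> 'a set"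
  assumes ext: "X \<subseteq> c X"
    and mono: "X \<subseteq> Y \<Longrightarrow> c X \<subseteq> c Y"
    and idem: "c (c X) \<subseteq> c X"
    and exch: "y \<in> c (insert x X) \<Longrightarrow> y \<notin> c X \<Longrightarrow> x \<in> c (insert y X)"
    and extend: "cl_indep c I \<Longrightarrow> I \<subseteq> X \<Longrightarrow> \<exists>B. I \<subseteq> B \<and> B \<subseteq> X \<and> cl_indep c B \<and> X \<subseteq> c B"
begin

lemma mem: "x \<in> X \<Longrightarrow> x \<in> c X"
  using ext by blast

lemma monoD: "x \<in> c X \<Longrightarrow> X \<subseteq> Y \<Longrightarrow> x \<in> c Y"
  using mono by blast

lemma le: "X \<subseteq> c Y \<Longrightarrow> c X \<subseteq> c Y"
  using idem mono by blast

lemma leD: "x \<in> c X \<Longrightarrow> X \<subseteq> c Y \<Longrightarrow> x \<in> c Y"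
  using le by blast

lemma eqI: "X \<subseteq> c Y \<Longrightarrow> Y \<subseteq> c X \<Longrightarrow> c X = c Y"
  using le by blast

lemma span_insert: "x \<in> c X \<Longrightarrow> c (insert x X) = c X"
  by (rule eqI) (use ext in blast)+

lemma Un_cong: "c X = c Y \<Longrightarrow> c (X \<union> Z) = c (Y \<union> Z)"
  proof (rule eqI)
  assume e: "c X = c Y"
  show "X \<union> Z \<subseteq> c (Y \<union> Z)" using e ext[of X] ext[of Z] mono[of Y "Y \<union> Z"] mono[of Z "Y \<union> Z"] by blast
  show "Y \<union> Z \<subseteq> c (X \<union> Z)" using e ext[of Y] ext[of Z] mono[of X "X \<union> Z"] mono[of Z "X \<union> Z"] by blast
qed

lemma cl_indep_empty: "cl_indep c {}"
  by (simp add: cl_indep_def)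

lemma cl_indep_subset: "cl_indep c B \<Longrightarrow> A \<subseteq> B \<Longrightarrow> cl_indep c A"
  unfolding cl_indep_def
proof (intro ballI notI)
  fix x assume a: "\<forall>x\<in>B. x \<notin> c (B - {x})" "A \<subseteq> B" "x \<in> A" "x \<in> c (A - {x})"
  then show False using monoD[of x "A - {x}" "B - {x}"] by blast
qed

lemma cl_indep_insert:
  assumes "cl_indep c B" "x \<notin> c B" shows "cl_indep c (insert x B)"
  unfolding cl_indep_def
proof (intro ballI)
  fix y assume y: "y \<in> insert x B"
  show "y \<notin> c (insert x B - {y})"
  proof (cases "y = x")
    case True
    have "x \<notin> B" using assms(2) mem[of x B] by blast
    then have "insert x B - {x} = B" by blast
    then show ?thesis using assms(2) True by simp
  next
    case False
    then have yB: "y \<in> B" using y by simp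
    have eq: "insert x B - {y} = insert x (B - {y})" using False by auto
    have "y \<notin> c (B - {y})" using assms(1) yB by (auto simp: cl_indep_def)
    moreover have "x \<notin> c (insert y (B - {y}))" using assms(2) yB by (simp add: insert_absorb insert_Diff)
    ultimately show ?thesis unfolding eq using exch by blast
  qed
qed

lemma cl_indepD: "cl_indep c B \<Longrightarrow> x \<in> B \<Longrightarrow> x \<notin> c (B - {x})"
  by (simp add: cl_indep_def)

lemma cl_indep_insertD: "cl_indep c (insert x B) \<Longrightarrow> x \<notin> B \<Longrightarrow> x \<notin> c B"
  by (auto simp: cl_indep_def)

lemma cl_indep_span_eq:
  assumes "cl_indep c S" "K \<subseteq> S" "S \<subseteq> c K" shows "K = S"
proof (rule ccontr)
  assume "K \<noteq> S"
  then obtain x where x: "x \<in> S" "x \<notin> K" using assms by blast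
  then have "x \<in> c (S - {x})" using assms monoD[of x K "S - {x}"] by blast
  then show False using assms x by (auto simp: cl_indep_def)
qed

lemma basis: "\<exists>B \<subseteq> X. cl_indep c B \<and> X \<subseteq> c B"
proof -
  obtain B where "B \<subseteq> X" "cl_indep c B" "X \<subseteq> c B"
    using extend[OF cl_indep_empty empty_subsetI[of X]] by (elim exE conjE) (rule that)
  then show ?thesis by (intro exI[of _ B] conjI)
qed

lemma maximal_in_iff:
  "maximal_in {B. B \<subseteq> W \<and> cl_indep c B} B \<longleftrightarrow> B \<subseteq> W \<and> cl_indep c B \<and> W \<subseteq> c B"
  (is "?l \<longleftrightarrow> ?r")
proof
  assume l: ?l
  have "w \<in> c B" if "w \<in> W" for w
  proof (rule ccontr)
    assume n: "w \<notin> c B"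
    then have "cl_indep c (insert w B)" using cl_indep_insert[of B w] l by (auto simp: maximal_in_def)
    then have "insert w B = B" using l that unfolding maximal_in_def by blast
    then show False using n mem[of w B] by blast
  qed
  then show ?r using l by (auto simp: maximal_in_def)
next
  assume r: ?r
  have "Y = B" if "Y \<subseteq> W" "cl_indep c Y" "B \<subseteq> Y" for Y
    using cl_indep_span_eq[OF that(2,3)] that(1) r by blast
  then show ?l using r by (auto simp: maximal_in_def)
qed

text \<open>The set on the right is the fundamental circuit of \<open>z\<close> with respect to \<open>S\<close>, without \<open>z\<close>.\<close>

lemma fund_circuit:
  assumes S: "cl_indep c S" and z: "z \<in> c S"
  shows "z \<in> c {i \<in> S. z \<notin> c (S - {i})}"
proof (rule ccontr)
  define C where "C = {i \<in> S. z \<notin> c (S - {i})}"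
  assume "z \<notin> c {i \<in> S. z \<notin> c (S - {i})}"
  then have zC: "z \<notin> c C" by (simp add: C_def)
  have CS: "C \<subseteq> S" by (auto simp: C_def)
  have zS: "z \<notin> S"
  proof
    assume "z \<in> S"
    then have "z \<in> C" using S by (auto simp: C_def cl_indep_def)
    then show False using zC mem[of z C] by blast
  qed
  \<comment> \<open>Some \<open>i\<close> of \<open>S\<close> is missing from a basis
    \<open>K\<close> of \<open>insert z S\<close> that contains \<open>z\<close> and
    \<open>C\<close>. Exchanging \<open>z\<close> for \<open>i\<close> must recover
    \<open>S\<close>, so \<open>K\<close> without \<open>z\<close> is \<open>S - {i}\<close>. As
    \<open>i\<close> is outside \<open>C\<close>, this set spans \<open>z\<close>, against the
    independence of \<open>K\<close>.\<close>
  have "cl_indep c (insert z C)" using cl_indep_insert cl_indep_subset S CS zC by blast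
  then obtain K where K: "insert z C \<subseteq> K" "K \<subseteq> insert z S" "cl_indep c K" "insert z S \<subseteq> c K"
    using extend[of "insert z C" "insert z S"] CS by blast
  define K' where "K' = K - {z}"
  have KK: "K = insert z K'" "K' \<subseteq> S" "z \<notin> K'" "C \<subseteq> K'"
    using K CS zS by (auto simp: K'_def)
  have zK: "z \<notin> c K'" using K(3) KK by (auto simp: cl_indep_def)
  have "K' \<noteq> S" using zK z by blast
  then obtain i where i: "i \<in> S" "i \<notin> K'" using KK by blast
  have iK: "i \<notin> c K'" using cl_indepD[OF S i(1)] monoD[of i K' "S - {i}"] KK(2) i(2) by blast
  have "i \<in> c (insert z K')" using i K KK by blast
  then have zi: "z \<in> c (insert i K')" using exch iK by blast
  have "S \<subseteq> c (insert z K')" using K KK by blast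
  moreover have "c (insert z K') \<subseteq> c (insert i K')"
    by (rule le) (use zi ext[of "insert i K'"] in blast)
  ultimately have "insert i K' = S" using cl_indep_span_eq[OF S, of "insert i K'"] i(1) KK(2) by blast
  then have "K' = S - {i}" using i by blast
  moreover have "z \<in> c (S - {i})" using i KK(4) by (auto simp: C_def)
  ultimately show False using zK by simp
qed

lemma exchange_swap:
  assumes B: "cl_indep c B" and i: "i \<in> B" "y \<in> c B" "y \<notin> c (B - {i})"
  shows "c (insert y (B - {i})) = c B" "cl_indep c (insert y (B - {i}))"
proof -
  have "i \<in> c (insert y (B - {i}))"
    using exch[of y i "B - {i}"] i by (simp add: insert_absorb)
  then show "c (insert y (B - {i})) = c B"
    using i ext[of "insert y (B - {i})"] ext[of B] by (intro eqI) blast+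
  show "cl_indep c (insert y (B - {i}))"
    using cl_indep_insert[of "B - {i}" y] cl_indep_subset[OF B, of "B - {i}"] i by blast
qed

text \<open>Every subset of the independent set \<open>S\<close> that spans \<open>z\<close>
  contains the fundamental circuit of \<open>z\<close>, so any family of such subsets may be
  intersected. The stability of closed sets under unions and intersections rests on this.\<close>

lemma Inter_span:
  assumes S: "cl_indep c S" and z: "z \<in> c S" and F: "\<And>X. X \<in> F \<Longrightarrow> X \<subseteq> S \<and> z \<in> c X"
  shows "z \<in> c (S \<inter> \<Inter>F)"
proof -
  have "{i \<in> S. z \<notin> c (S - {i})} \<subseteq> S \<inter> \<Inter>F"
  proof
    fix i assume i: "i \<in> {i \<in> S. z \<notin> c (S - {i})}"
    have "i \<in> X" if "X \<in> F" for X
      using F[OF that] i monoD[of z X "S - {i}"] by blast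
    then show "i \<in> S \<inter> \<Inter>F" using i by blast
  qed
  then show ?thesis by (rule monoD[OF fund_circuit[OF S z]])
qed

lemma Int_span:
  assumes "cl_indep c S" "X \<subseteq> S" "Y \<subseteq> S" "z \<in> c X" "z \<in> c Y"
  shows "z \<in> c (X \<inter> Y)"
proof -
  have "z \<in> c (S \<inter> \<Inter>{X, Y})"
    by (rule Inter_span[OF assms(1) monoD[OF assms(4,2)]]) (use assms in blast)
  then show ?thesis using assms by (simp add: inf.absorb2 inf.coboundedI1)
qed

end

section \<open>Minors, duals and finitariness of closure operators\<close>

definition cl_contract :: "('a set \<Rightarrow> 'a set) \<Rightarrow> 'a set \<Rightarrow> 'a set \<Rightarrow> 'a set" where
  "cl_contract c Y X = c (X \<union> Y)"

definition cl_restrict :: "('a set \<Rightarrow> 'a set) \<Rightarrow> 'a set \<Rightarrow> 'a set \<Rightarrow> 'a set" where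
  "cl_restrict c J X = c (X - J) \<union> J"

definition cl_minor :: "('a set \<Rightarrow> 'a set) \<Rightarrow> 'a set \<Rightarrow> 'a set \<Rightarrow> 'a set \<Rightarrow> 'a set" where
  "cl_minor c I J = cl_restrict (cl_contract c I) J"

text \<open>The added elements are the coloops of the restriction to the complement of
  \<open>X\<close>.\<close>

definition cl_dual :: "('a set \<Rightarrow> 'a set) \<Rightarrow> 'a set \<Rightarrow> 'a set" where
  "cl_dual c X = X \<union> {x. x \<notin> c (- X - {x})}"

definition cl_finitary :: "('a set \<Rightarrow> 'a set) \<Rightarrow> bool" where
  "cl_finitary c \<longleftrightarrow> (\<forall>X x. x \<in> c X \<longrightarrow> (\<exists>F \<subseteq> X. finite F \<and> x \<in> c F))"

lemma cl_finitaryE: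
  assumes "cl_finitary c" "x \<in> c X"
  obtains F where "F \<subseteq> X" "finite F" "x \<in> c F"
  using assms unfolding cl_finitary_def by (elim allE[of _ X] allE[of _ x]) auto

lemma cl_finitaryI:
  "(\<And>X x. x \<in> c X \<Longrightarrow> \<exists>F \<subseteq> X. finite F \<and> x \<in> c F) \<Longrightarrow> cl_finitary c"
  unfolding cl_finitary_def by simp

context closure_matroid
begin

text \<open>A basis of \<open>K \<union> I\<close> above \<open>K\<close> cannot omit an
  \<open>i\<close> of \<open>I\<close>: it would span \<open>i\<close> by \<open>K\<close> and the
  rest of \<open>I\<close> alone.\<close>

lemma cl_indep_Un:
  assumes K: "cl_indep c K" and I: "cl_indep (cl_contract c K) I" shows "cl_indep c (K \<union> I)"
proof -
  obtain B where B: "K \<subseteq> B" "B \<subseteq> K \<union> I" "cl_indep c B" "K \<union> I \<subseteq> c B"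
    using extend[OF K, of "K \<union> I"] by blast
  have "i \<in> B" if i: "i \<in> I" for i
  proof (rule ccontr)
    assume "i \<notin> B"
    then have "B \<subseteq> I - {i} \<union> K" using B by blast
    moreover have "i \<in> c B" using B i by blast
    ultimately have "i \<in> c (I - {i} \<union> K)" by (rule monoD[rotated])
    then show False using bspec[OF I[unfolded cl_indep_def cl_contract_def] i] by simp
  qed
  then have "B = K \<union> I" using B by blast
  then show ?thesis using B by simp
qed

lemma cl_indep_contract_mono:
  assumes I: "cl_indep (cl_contract c Y) I" "K \<subseteq> c Y" shows "cl_indep (cl_contract c K) I"
  unfolding cl_indep_def cl_contract_def
proof (intro ballI notI)
  fix x assume x: "x \<in> I" "x \<in> c (I - {x} \<union> K)"
  have "I - {x} \<union> K \<subseteq> c (I - {x} \<union> Y)"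
    using assms(2) ext[of "I - {x} \<union> Y"] mono[of Y "I - {x} \<union> Y"] by blast
  then have "x \<in> c (I - {x} \<union> Y)" by (rule leD[OF x(2)])
  then show False using bspec[OF I(1)[unfolded cl_indep_def cl_contract_def] x(1)] by simp
qed

lemma cl_indep_contract_of_Un:
  assumes "cl_indep c (K \<union> I)" "K \<inter> I = {}" shows "cl_indep (cl_contract c K) I"
  unfolding cl_indep_def cl_contract_def
proof (intro ballI)
  fix x assume x: "x \<in> I"
  then have "I - {x} \<union> K = K \<union> I - {x}" using assms(2) by blast
  then show "x \<notin> c (I - {x} \<union> K)" using cl_indepD[OF assms(1), of x] x by simp
qed

lemma contract_contract: "cl_contract (cl_contract c Y) K = cl_contract c (K \<union> Y)"
  by (rule HOL.ext) (simp add: cl_contract_def Un_assoc)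

lemma cl_indep_contract_disj:
  assumes "cl_indep (cl_contract c Y) I" shows "I \<inter> c Y = {}"
proof -
  have "x \<notin> c Y" if "x \<in> I" for x
    using bspec[OF assms[unfolded cl_indep_def cl_contract_def] that] mono[of Y "I - {x} \<union> Y"] by blast
  then show ?thesis by blast
qed

lemma closure_matroid_contract: "closure_matroid (cl_contract c Y)"
proof
  show "X \<subseteq> cl_contract c Y X" for X using mem by (auto simp: cl_contract_def)
  show "X \<subseteq> Z \<Longrightarrow> cl_contract c Y X \<subseteq> cl_contract c Y Z" for X Z unfolding cl_contract_def by (intro mono) blast
  show "cl_contract c Y (cl_contract c Y X) \<subseteq> cl_contract c Y X" for X
    unfolding cl_contract_def by (rule le) (use mem in auto)
  show "x \<in> cl_contract c Y (insert y X)" if "y \<in> cl_contract c Y (insert x X)" "y \<notin> cl_contract c Y X" for x y X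
    using that exch by (simp add: cl_contract_def)
  fix I X assume I: "cl_indep (cl_contract c Y) I" and IX: "I \<subseteq> X"
  \<comment> \<open>\<open>Y\<close> acts only through a basis \<open>K\<close>. Removing
    \<open>K\<close> from a basis of \<open>K \<union> X\<close> above \<open>K \<union> I\<close>
    leaves the required basis over \<open>Y\<close>.\<close>
  obtain K where K: "K \<subseteq> Y" "cl_indep c K" "Y \<subseteq> c K" using basis by blast
  have "cl_indep c (K \<union> I)" using cl_indep_Un[OF K(2) cl_indep_contract_mono[OF I]] K(1) ext[of Y] by blast
  then obtain B1 where B1: "K \<union> I \<subseteq> B1" "B1 \<subseteq> K \<union> X" "cl_indep c B1" "K \<union> X \<subseteq> c B1"
    using extend[of "K \<union> I" "K \<union> X"] IX by blast
  have "I \<inter> K = {}" using cl_indep_contract_disj[OF I] K(1) ext[of Y] by blast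
  then have 1: "I \<subseteq> B1 - K" using B1 by blast
  have 2: "cl_indep (cl_contract c Y) (B1 - K)"
    unfolding cl_indep_def cl_contract_def
  proof (intro ballI notI)
    fix x assume x: "x \<in> B1 - K" "x \<in> c (B1 - K - {x} \<union> Y)"
    have "B1 - K - {x} \<union> Y \<subseteq> c (B1 - {x})"
    proof -
      have "K \<subseteq> B1 - {x}" using B1(1) x(1) by blast
      then have "Y \<subseteq> c (B1 - {x})" using K(3) mono[of K "B1 - {x}"] by blast
      moreover have "B1 - K - {x} \<subseteq> c (B1 - {x})" using ext[of "B1 - {x}"] by blast
      ultimately show ?thesis by blast
    qed
    then have "x \<in> c (B1 - {x})" by (rule leD[OF x(2)])
    then show False using cl_indepD[OF B1(3), of x] x(1) by blast
  qed
  have "B1 \<subseteq> c (B1 - K \<union> Y)" using K(1) ext[of "B1 - K \<union> Y"] by blast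
  then have "X \<subseteq> cl_contract c Y (B1 - K)" using B1(4) le[of B1 "B1 - K \<union> Y"] unfolding cl_contract_def by blast
  then show "\<exists>B. I \<subseteq> B \<and> B \<subseteq> X \<and> cl_indep (cl_contract c Y) B \<and> X \<subseteq> cl_contract c Y B"
    using 1 2 B1 by blast
qed

lemma cl_indep_restrict: "cl_indep (cl_restrict c J) I \<longleftrightarrow> cl_indep c I \<and> I \<inter> J = {}"
proof (cases "I \<inter> J = {}")
  case True
  then have "I - {x} - J = I - {x}" for x by blast
  moreover have "x \<notin> J" if "x \<in> I" for x using True that by blast
  ultimately show ?thesis using True by (simp add: cl_indep_def cl_restrict_def)
next
  case False
  then show ?thesis by (auto simp: cl_indep_def cl_restrict_def)
qed

lemma closure_matroid_restrict: "closure_matroid (cl_restrict c J)"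
proof
  show "X \<subseteq> cl_restrict c J X" for X using mem by (auto simp: cl_restrict_def)
  show "X \<subseteq> Z \<Longrightarrow> cl_restrict c J X \<subseteq> cl_restrict c J Z" for X Z
    using mono[of "X - J" "Z - J"] unfolding cl_restrict_def by blast
  have "c (c (X - J) \<union> J - J) \<subseteq> c (X - J)" for X
    by (rule le) auto
  then show "cl_restrict c J (cl_restrict c J X) \<subseteq> cl_restrict c J X" for X
    unfolding cl_restrict_def by blast
  show "x \<in> cl_restrict c J (insert y X)" if "y \<in> cl_restrict c J (insert x X)" "y \<notin> cl_restrict c J X" for x y X
    using that exch[of y x "X - J"] by (auto simp: cl_restrict_def insert_Diff_if split: if_splits)
  fix I X assume I: "cl_indep (cl_restrict c J) I" and IX: "I \<subseteq> X"
  then obtain B where "I \<subseteq> B" "B \<subseteq> X - J" "cl_indep c B" "X - J \<subseteq> c B"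
    using extend[of I "X - J"] by (auto simp: cl_indep_restrict)
  moreover from this have "B - J = B" by blast
  ultimately show "\<exists>B. I \<subseteq> B \<and> B \<subseteq> X \<and> cl_indep (cl_restrict c J) B \<and> X \<subseteq> cl_restrict c J B"
    by (intro exI[of _ B]) (auto simp: cl_indep_restrict cl_restrict_def)
qed

lemma cl_indep_dual: "cl_indep (cl_dual c) I \<longleftrightarrow> c (- I) = UNIV"
proof -
  have "- (I - {x}) - {x} = - I" if "x \<in> I" for x using that by blast
  then have "cl_indep (cl_dual c) I \<longleftrightarrow> I \<subseteq> c (- I)"
    unfolding cl_indep_def cl_dual_def by auto
  moreover have "- I \<subseteq> c (- I)" using ext[of "- I"] by blast
  ultimately show ?thesis by blast
qed

lemma closure_matroid_dual: "closure_matroid (cl_dual c)"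
proof
  show "X \<subseteq> cl_dual c X" for X by (auto simp: cl_dual_def)
  have anti: "c (- Z - {x}) \<subseteq> c (- X - {x})" if "X \<subseteq> Z" for X Z x
    using that by (intro mono) auto
  show "cl_dual c X \<subseteq> cl_dual c Z" if "X \<subseteq> Z" for X Z
    using that anti[OF that] by (auto simp: cl_dual_def)
  show "cl_dual c (cl_dual c X) \<subseteq> cl_dual c X" for X
  proof
    fix x assume x: "x \<in> cl_dual c (cl_dual c X)"
    show "x \<in> cl_dual c X"
    proof (rule ccontr)
      assume nx: "x \<notin> cl_dual c X"
      \<comment> \<open>Idempotence: \<open>x\<close> is spanned by \<open>D \<union> A\<close> but
        not by \<open>A\<close>, so its fundamental circuit over \<open>A\<close> contains some
        \<open>b\<close> of \<open>D\<close>. Exchanging \<open>b\<close> with \<open>x\<close>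
        shows that \<open>b\<close> is spanned by \<open>- X - {b}\<close>, although
        \<open>b\<close> belongs to the dual closure of \<open>X\<close>.\<close>
      define A where "A = - cl_dual c X - {x}"
      define D where "D = cl_dual c X - X"
      have xA: "x \<notin> c A" using x nx by (auto simp: cl_dual_def A_def)
      have XA: "- X - {x} = D \<union> A" using nx by (auto simp: A_def D_def cl_dual_def)
      have xD: "x \<in> cl_contract c A D" using nx XA by (auto simp: cl_dual_def cl_contract_def)
      interpret A: closure_matroid "cl_contract c A" by (rule closure_matroid_contract)
      obtain D0 where D0: "D0 \<subseteq> D" "cl_indep (cl_contract c A) D0" "D \<subseteq> cl_contract c A D0" using A.basis by blast
      have xD0: "x \<in> cl_contract c A D0" by (rule A.leD[OF xD D0(3)])
      then have "x \<in> cl_contract c A {i \<in> D0. x \<notin> cl_contract c A (D0 - {i})}" using A.fund_circuit[OF D0(2) xD0] by simp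
      moreover have "x \<notin> cl_contract c A {}" using xA by (simp add: cl_contract_def)
      ultimately obtain b where b: "b \<in> D0" "x \<notin> cl_contract c A (D0 - {b})"
        by (metis (mono_tags, lifting) Collect_empty_eq)
      moreover have "x \<in> cl_contract c A (insert b (D0 - {b}))" using xD0 b by (simp add: insert_absorb)
      ultimately have "b \<in> cl_contract c A (insert x (D0 - {b}))" using A.exch[of x b "D0 - {b}"] by blast
      moreover have "insert x (D0 - {b}) \<union> A \<subseteq> - X - {b}"
        using D0 b nx by (auto simp: A_def D_def cl_dual_def)
      ultimately have "b \<in> c (- X - {b})" unfolding cl_contract_def by (rule monoD)
      then show False using b D0 by (auto simp: D_def cl_dual_def)
    qed
  qed
  show "x \<in> cl_dual c (insert y X)" if y: "y \<in> cl_dual c (insert x X)" "y \<notin> cl_dual c X" for x y X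
  proof (cases "x = y \<or> x \<in> X")
    case True
    then show ?thesis using y by (auto simp: cl_dual_def insert_absorb)
  next
    case False
    define Z where "Z = - X - {x, y}"
    have eq: "- X - {y} = insert x Z" "- insert x X - {y} = Z" "- insert y X - {x} = Z"
      using False y by (auto simp: Z_def cl_dual_def)
    have "y \<in> c (insert x Z)" "y \<notin> c Z" using y False eq by (auto simp: cl_dual_def)
    then have "x \<notin> c Z" using span_insert[of x Z] by blast
    then show ?thesis using eq by (auto simp: cl_dual_def)
  qed
  fix I X assume I: "cl_indep (cl_dual c) I" and IX: "I \<subseteq> X"
  \<comment> \<open>Extension by complements: a basis of \<open>- X\<close> is enlarged to a basis
    \<open>K\<close> of \<open>- I\<close>, which spans everything because \<open>I\<close> is
    dually independent. Then \<open>X - K\<close> is the dual basis sought.\<close>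
  obtain K0 where K0: "K0 \<subseteq> - X" "cl_indep c K0" "- X \<subseteq> c K0" using basis by blast
  then obtain K where K: "K0 \<subseteq> K" "K \<subseteq> - I" "cl_indep c K" "- I \<subseteq> c K"
    using extend[of K0 "- I"] IX by blast
  have cK: "c K = UNIV" using I K(4) le[of "- I" K] unfolding cl_indep_dual by blast
  let ?B = "X - K"
  have "c (- ?B) = UNIV" using cK mono[of K "- ?B"] by blast
  then have "cl_indep (cl_dual c) ?B" by (simp add: cl_indep_dual)
  moreover have "x \<in> cl_dual c ?B" if x: "x \<in> X" "x \<in> K" for x
  proof -
    have "- ?B - {x} \<subseteq> c (K - {x})"
    proof
      fix z assume z: "z \<in> - ?B - {x}"
      show "z \<in> c (K - {x})"
      proof (cases "z \<in> K")
        case True then show ?thesis using z mem[of z "K - {x}"] by blast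
      next
        case False
        then have "z \<in> c K0" using z K0 by blast
        then show ?thesis using monoD[of z K0 "K - {x}"] K K0 x by blast
      qed
    qed
    then have "x \<notin> c (- ?B - {x})" using leD[of x "- ?B - {x}" "K - {x}"] cl_indepD[OF K(3) x(2)] by blast
    then show ?thesis by (simp add: cl_dual_def)
  qed
  then have "X \<subseteq> cl_dual c ?B" by (auto simp: cl_dual_def)
  ultimately show "\<exists>B. I \<subseteq> B \<and> B \<subseteq> X \<and> cl_indep (cl_dual c) B \<and> X \<subseteq> cl_dual c B"
    using IX K by (intro exI[of _ ?B]) blast
qed

lemma dual_dual: "cl_dual (cl_dual c) = c"
proof
  fix X show "cl_dual (cl_dual c) X = c X"
  proof (rule set_eqI)
    fix x
    have "- (- X - {x}) - {x} = X - {x}" by blast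
    then show "x \<in> cl_dual (cl_dual c) X \<longleftrightarrow> x \<in> c X"
      using mem[of x X] by (cases "x \<in> X") (auto simp: cl_dual_def)
  qed
qed

lemma minor_eq: "X \<inter> J = {} \<Longrightarrow> cl_minor c I J X = c (X \<union> I) \<union> J"
  unfolding cl_minor_def cl_restrict_def cl_contract_def by (simp add: Diff_triv)

lemma minor_loops: "I \<union> J \<subseteq> cl_minor c I J X"
  unfolding cl_minor_def cl_restrict_def cl_contract_def using ext[of "X - J \<union> I"] by blast

lemma cl_finitary_contract:
  assumes f: "cl_finitary c" shows "cl_finitary (cl_contract c Y)"
proof (rule cl_finitaryI)
  fix X x assume "x \<in> cl_contract c Y X"
  then have "x \<in> c (X \<union> Y)" by (simp add: cl_contract_def)
  then obtain F where F: "F \<subseteq> X \<union> Y" "finite F" "x \<in> c F" by (rule cl_finitaryE[OF f])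
  have "x \<in> cl_contract c Y (F \<inter> X)" unfolding cl_contract_def by (rule monoD[OF F(3)]) (use F in blast)
  then show "\<exists>F \<subseteq> X. finite F \<and> x \<in> cl_contract c Y F"
    using F by (intro exI[of _ "F \<inter> X"]) simp
qed

lemma cl_finitary_restrict:
  assumes f: "cl_finitary c" shows "cl_finitary (cl_restrict c J)"
proof (rule cl_finitaryI)
  fix X x assume x: "x \<in> cl_restrict c J X"
  show "\<exists>F \<subseteq> X. finite F \<and> x \<in> cl_restrict c J F"
  proof (cases "x \<in> J")
    case True
    then show ?thesis by (intro exI[of _ "{}"]) (simp add: cl_restrict_def)
  next
    case False
    then have "x \<in> c (X - J)" using x by (simp add: cl_restrict_def)
    then obtain F where F: "F \<subseteq> X - J" "finite F" "x \<in> c F" by (rule cl_finitaryE[OF f])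
    have "F - J = F" using F(1) by blast
    then have "x \<in> cl_restrict c J F" using F(3) by (simp add: cl_restrict_def)
    then show ?thesis using F by (intro exI[of _ F]) blast
  qed
qed

lemma cl_finitary_UN:
  assumes f: "cl_finitary c" and inc: "\<And>m n. m \<le> n \<Longrightarrow> X m \<subseteq> X n" and x: "x \<in> c (\<Union>n::nat. X n)"
  shows "\<exists>n. x \<in> c (X n)"
proof -
  obtain F where F: "F \<subseteq> (\<Union>n. X n)" "finite F" "x \<in> c F" by (rule cl_finitaryE[OF f x])
  have "\<exists>n. F \<subseteq> X n" using F(2,1)
  proof (induction F)
    case (insert y F)
    obtain n m where "F \<subseteq> X n" "y \<in> X m" using insert by auto
    then show ?case using inc[of n "max n m"] inc[of m "max n m"] by (intro exI[of _ "max n m"]) auto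
  qed auto
  then show ?thesis using monoD[OF F(3)] by blast
qed

lemma cl_indep_UN:
  assumes f: "cl_finitary c" and inc: "\<And>m n. m \<le> n \<Longrightarrow> X m \<subseteq> X n" and i: "\<And>n::nat. cl_indep c (X n)"
  shows "cl_indep c (\<Union>n. X n)"
  unfolding cl_indep_def
proof (intro ballI notI)
  fix x assume x: "x \<in> (\<Union>n. X n)" "x \<in> c ((\<Union>n. X n) - {x})"
  have "(\<Union>n. X n) - {x} = (\<Union>n. X n - {x})" by blast
  then obtain n where n: "x \<in> c (X n - {x})"
    using cl_finitary_UN[OF f, of "\<lambda>n. X n - {x}" x] inc x by (metis Diff_mono order_refl)
  obtain m where m: "x \<in> X m" using x by blast
  let ?k = "max n m"
  have "x \<in> X ?k" using m inc[of m ?k] by auto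
  moreover have "x \<in> c (X ?k - {x})" using n inc[of n ?k] by (elim monoD) auto
  ultimately show False using i by (auto simp: cl_indep_def)
qed

text \<open>For \<open>x\<close> outside \<open>X\<close>, the fundamental circuit of
  \<open>x\<close> with respect to a basis of \<open>X\<close>, with \<open>x\<close> added, is a
  minimal dependent set. Its finiteness gives the finite spanning subset.\<close>

lemma cl_finitary_circuits:
  assumes fin: "\<And>C. \<not> cl_indep c C \<Longrightarrow> (\<And>Y. Y \<subset> C \<Longrightarrow> cl_indep c Y) \<Longrightarrow> finite C"
  shows "cl_finitary c"
proof (rule cl_finitaryI)
  fix X x assume x: "x \<in> c X"
  show "\<exists>F\<subseteq>X. finite F \<and> x \<in> c F"
  proof (cases "x \<in> X")
    case True
    then show ?thesis using mem[of x "{x}"] by (intro exI[of _ "{x}"]) auto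
  next
    case False
    obtain S where S: "S \<subseteq> X" "cl_indep c S" "X \<subseteq> c S" using basis by blast
    define C where "C = {i \<in> S. x \<notin> c (S - {i})}"
    have xS: "x \<in> c S" by (rule leD[OF x S(3)])
    then have xC: "x \<in> c C" using fund_circuit[OF S(2)] by (simp add: C_def)
    have nx: "x \<notin> S" using False S by blast
    have C: "C \<subseteq> S" by (auto simp: C_def)
    have "finite (insert x C)"
    proof (rule fin)
      show "\<not> cl_indep c (insert x C)" using xC nx C cl_indep_insertD[of x C] by blast
      fix Y assume Y: "Y \<subset> insert x C"
      show "cl_indep c Y"
      proof (cases "x \<in> Y")
        case False
        then show ?thesis using Y C cl_indep_subset[OF S(2), of Y] by blast
      next
        case True
        then obtain i where i: "i \<in> C" "i \<notin> Y" using Y by blast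
        have "Y - {x} \<subseteq> S - {i}" using Y C i by blast
        then have "x \<notin> c (Y - {x})" using i monoD[of x "Y - {x}" "S - {i}"] by (auto simp: C_def)
        moreover have "cl_indep c (Y - {x})" using \<open>Y - {x} \<subseteq> S - {i}\<close> cl_indep_subset[OF S(2), of "Y - {x}"] by blast
        ultimately have "cl_indep c (insert x (Y - {x}))" by (rule cl_indep_insert[rotated])
        then show ?thesis using True by (simp add: insert_absorb)
      qed
    qed
    then show ?thesis using xC C S by (intro exI[of _ C]) auto
  qed
qed

end

section \<open>Alternating paths, waves and feasible sets\<close>

text \<open>\<open>R\<close> is closed under the arcs of the exchange graph of \<open>B\<close> and contains no element outside the
  \<open>M\<close>-span of \<open>B\<close>, so no augmenting path starts in \<open>R\<close>.\<close>

definition closed_set :: "('a set \<Rightarrow> 'a set) \<Rightarrow> ('a set \<Rightarrow> 'a set) \<Rightarrow> 'a set \<Rightarrow> 'a set \<Rightarrow> bool" where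
  "closed_set M N B R \<longleftrightarrow> R \<subseteq> M (B \<inter> R) \<and> N B - R \<subseteq> N (B - R)"

text \<open>Two consecutive arcs \<open>y \<rightarrow> i \<rightarrow> z\<close> of the exchange graph.\<close>

definition swap_step :: "('a set \<Rightarrow> 'a set) \<Rightarrow> ('a set \<Rightarrow> 'a set) \<Rightarrow> 'a set \<Rightarrow> ('a \<times> 'a) set" where
  "swap_step M N B = {(y, z). y \<notin> B \<and> z \<notin> B \<and>
    (\<exists>i\<in>B. y \<in> M B \<and> y \<notin> M (B - {i}) \<and> z \<in> N B \<and> z \<notin> N (B - {i}))}"

text \<open>\<open>W\<close> is a wave of \<open>(M/I, N/I)\<close> with witness \<open>B\<close>; as \<open>I \<subseteq> - W\<close>, contracting \<open>I\<close> in \<open>N\<close> makes no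
  difference. \<open>I\<close> is feasible if all these waves are trivial.\<close>

definition rel_wave :: "('a set \<Rightarrow> 'a set) \<Rightarrow> ('a set \<Rightarrow> 'a set) \<Rightarrow> 'a set \<Rightarrow> 'a set \<Rightarrow> 'a set \<Rightarrow> bool" where
  "rel_wave M N I W B \<longleftrightarrow> B \<subseteq> W \<and> W \<inter> I = {} \<and> W \<subseteq> M (I \<union> B) \<and> cl_indep (cl_contract N (- W)) B"

definition feasible :: "('a set \<Rightarrow> 'a set) \<Rightarrow> ('a set \<Rightarrow> 'a set) \<Rightarrow> 'a set \<Rightarrow> bool" where
  "feasible M N I \<longleftrightarrow> cl_indep M I \<and> cl_indep N I \<and>
    (\<forall>W B. rel_wave M N I W B \<longrightarrow> W \<subseteq> M I \<and> W \<subseteq> N (- W))"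

locale closure_matroid_pair = M: closure_matroid M + N: closure_matroid N
  for M N :: "'a set \<Rightarrow> 'a set"
begin

text \<open>Along a shortest path, performing the first swap does not destroy the later arcs.\<close>

lemma augment_path:
  assumes "cl_indep M B" "cl_indep N B" "s \<notin> N B" "t \<notin> M B" "(s, t) \<in> swap_step M N B ^^ n"
  shows "\<exists>B'. cl_indep M B' \<and> cl_indep N B' \<and> t \<in> B' \<and> M B' = M (insert t B) \<and> N B' = N (insert s B)"
  using assms
proof (induction n arbitrary: B s rule: less_induct)
  case (less n)
  note MB = less.prems(1) and NB = less.prems(2) and s = less.prems(3) and t = less.prems(4)
  have sB: "s \<notin> B" using s N.mem[of s B] by blast
  show ?case
  \<comment> \<open>The strong induction allows \<open>n\<close> to be taken as the distance from
    \<open>s\<close> to \<open>t\<close>.\<close>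
  proof (cases "\<exists>k<n. (s, t) \<in> swap_step M N B ^^ k")
    case True
    then obtain k where "k < n" "(s, t) \<in> swap_step M N B ^^ k" by blast
    then show ?thesis using less.IH[of k B s] less.prems by blast
  next
    case False
    then have short: "(s, t) \<notin> swap_step M N B ^^ k" if "k < n" for k using that by blast
    show ?thesis
    proof (cases n)
      case 0
      then have "s = t" using less.prems by simp
      then show ?thesis
        using M.cl_indep_insert[OF MB t] N.cl_indep_insert[OF NB s] by (intro exI[of _ "insert s B"]) simp
    next
      case (Suc m)
      then have "(s, t) \<in> swap_step M N B ^^ Suc m" using less.prems(5) by simp
      then obtain y where y: "(s, y) \<in> swap_step M N B" "(y, t) \<in> swap_step M N B ^^ m"
        by (meson relpow_Suc_D2)
      then obtain i where i: "i \<in> B" "s \<in> M B" "s \<notin> M (B - {i})" "y \<in> N B" "y \<notin> N (B - {i})"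
        and yB: "y \<notin> B" by (auto simp: swap_step_def)
      define B1 where "B1 = insert s (B - {i})"
      have MB1: "M B1 = M B" "cl_indep M B1"
        using M.exchange_swap[OF MB i(1-3)] by (simp_all add: B1_def)
      have NBs: "cl_indep N (insert s B)" by (rule N.cl_indep_insert[OF NB s])
      have NB1: "cl_indep N B1" by (rule N.cl_indep_subset[OF NBs]) (auto simp: B1_def)
      \<comment> \<open>As \<open>insert s B\<close> is independent in \<open>N\<close>, its new
        element \<open>s\<close> opens no new way of spanning an element of
        \<open>N B\<close>.\<close>
      have N_avoid: "z \<in> N (B - J)" if "z \<in> N B" "z \<in> N (insert s B - J)" for z J
      proof -
        have "z \<in> N (B \<inter> (insert s B - J))"
          by (rule N.Int_span[OF NBs]) (use that in auto)
        moreover have "B \<inter> (insert s B - J) = B - J" by blast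
        ultimately show ?thesis by simp
      qed
      have B1_sub: "B1 = insert s B - {i}" using i sB by (auto simp: B1_def)
      have y1: "y \<notin> N B1" using N_avoid[of y "{i}"] i B1_sub by auto
      have "i \<in> N (insert y (B - {i}))"
        using N.exch[of y i "B - {i}"] i by (simp add: insert_absorb)
      then have NB1y: "N (insert y B1) = N (insert s B)"
      proof (intro N.eqI)
        have "y \<in> N (insert s B)" by (rule N.monoD[OF i(4)]) blast
        then show "insert y B1 \<subseteq> N (insert s B)" using N.ext[of "insert s B"] by (auto simp: B1_def)
        assume iN: "i \<in> N (insert y (B - {i}))"
        have "i \<in> N (insert y B1)" by (rule N.monoD[OF iN]) (auto simp: B1_def)
        then show "insert s B \<subseteq> N (insert y B1)" using N.ext[of "insert y B1"] by (auto simp: B1_def)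
      qed
      have step: "(u, t) \<in> swap_step M N B1 ^^ k"
        if "(u, t) \<in> swap_step M N B ^^ k" "k \<le> m" "u \<notin> B" "u \<noteq> s" for k u
        using that
      proof (induction k arbitrary: u)
        case (Suc k)
        obtain v where v: "(u, v) \<in> swap_step M N B" "(v, t) \<in> swap_step M N B ^^ k"
          using Suc.prems(1) by (meson relpow_Suc_D2)
        then obtain j where j: "j \<in> B" "u \<in> M B" "u \<notin> M (B - {j})" "v \<in> N B" "v \<notin> N (B - {j})"
          and vB: "v \<notin> B" by (auto simp: swap_step_def)
        have vs: "v \<noteq> s" using j s by blast
        have nsv: "(s, v) \<notin> swap_step M N B"
        proof
          assume "(s, v) \<in> swap_step M N B"
          then have "(s, t) \<in> swap_step M N B ^^ Suc k" using v relpow_Suc_I2[of s v "swap_step M N B" t k] by blast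
          then show False using short[of "Suc k"] Suc.prems \<open>n = Suc m\<close> by simp
        qed
        have ji: "j \<noteq> i" using nsv i j sB vB by (auto simp: swap_step_def)
        have vi: "v \<in> N (B - {i})" using nsv i j sB vB by (auto simp: swap_step_def)
        have sj: "s \<in> M (B - {j})" using nsv i j sB vB by (auto simp: swap_step_def)
        have "B1 - {j} \<subseteq> M (B - {j})" using sj M.ext[of "B - {j}"] by (auto simp: B1_def)
        then have u1: "u \<notin> M (B1 - {j})" using j M.leD[of u "B1 - {j}" "B - {j}"] by blast
        have v1: "v \<in> N B1" by (rule N.monoD[OF vi]) (auto simp: B1_def)
        have v2: "v \<notin> N (B1 - {j})"
        proof
          assume a: "v \<in> N (B1 - {j})"
          have "v \<in> N (insert s B - {j})" by (rule N.monoD[OF a]) (auto simp: B1_def)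
          then show False using N_avoid[of v "{j}"] j by blast
        qed
        have "(u, v) \<in> swap_step M N B1"
          using u1 v1 v2 j ji MB1 Suc.prems vB vs by (auto simp: swap_step_def B1_def)
        moreover have "(v, t) \<in> swap_step M N B1 ^^ k" using Suc.IH[OF v(2)] Suc.prems vB vs by simp
        ultimately show ?case by (rule relpow_Suc_I2)
      qed simp
      have "y \<noteq> s" using i s by blast
      then have "(y, t) \<in> swap_step M N B1 ^^ m" using step[OF y(2)] yB by simp
      then obtain B' where B': "cl_indep M B'" "cl_indep N B'" "t \<in> B'" "M B' = M (insert t B1)" "N B' = N (insert y B1)"
        using less.IH[of m B1 y] Suc MB1 NB1 y1 t by auto
      moreover have "M (insert t B1) = M (insert t B)"
        using M.Un_cong[OF MB1(1), of "{t}"] by simp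
      ultimately show ?thesis using NB1y by auto
    qed
  qed
qed

text \<open>If nothing outside \<open>M B\<close> were reachable from \<open>s\<close>, the
  reachable elements, together with the elements of \<open>B\<close> passed on the way, would form a
  closed set containing \<open>s\<close>. Both closedness conditions are read off from fundamental
  circuits.\<close>

lemma augment:
  assumes MB: "cl_indep M B" and NB: "cl_indep N B" and s: "s \<notin> N B"
    and unblocked: "\<And>R. closed_set M N B R \<Longrightarrow> s \<notin> R"
  obtains B' t where "cl_indep M B'" "cl_indep N B'" "t \<in> B'" "t \<notin> M B" "M B' = M (insert t B)" "N B' = N (insert s B)"
proof -
  define P where "P = {y. (s, y) \<in> (swap_step M N B)\<^sup>*}"
  define R where "R = P \<union> {i \<in> B. \<exists>y\<in>P. y \<in> M B \<and> y \<notin> M (B - {i})}"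
  have sB: "s \<notin> B" using s N.mem[of s B] by blast
  have PB: "y \<notin> B" if "y \<in> P" for y
    using that sB unfolding P_def by (auto elim!: rtranclE simp: swap_step_def)
  have "\<exists>t\<in>P. t \<notin> M B"
  proof (rule ccontr)
    assume "\<not> ?thesis"
    then have PM: "P \<subseteq> M B" by blast
    have "R \<subseteq> M (B \<inter> R)"
    proof
      fix y assume y: "y \<in> R"
      show "y \<in> M (B \<inter> R)"
      proof (cases "y \<in> P")
        case True
        then have "y \<in> M B" using PM by blast
        then have "y \<in> M {i \<in> B. y \<notin> M (B - {i})}" by (rule M.fund_circuit[OF MB])
        then show ?thesis by (rule M.monoD) (use True PM in \<open>auto simp: R_def\<close>)
      next
        case False
        then show ?thesis using y M.mem[of y "B \<inter> R"] by (auto simp: R_def)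
      qed
    qed
    moreover have "N B - R \<subseteq> N (B - R)"
    proof
      fix z assume z: "z \<in> N B - R"
      then have "z \<in> N {i \<in> B. z \<notin> N (B - {i})}" using N.fund_circuit[OF NB] by blast
      then show "z \<in> N (B - R)"
      proof (rule N.monoD)
        have "i \<notin> R" if i: "i \<in> B" "z \<notin> N (B - {i})" for i
        proof (cases "z \<in> B")
          case True
          then have "z = i" using i N.mem[of z "B - {i}"] by blast
          then show ?thesis using z by blast
        next
          case False
          show ?thesis
          proof
            assume "i \<in> R"
            then obtain y where y: "y \<in> P" "y \<in> M B" "y \<notin> M (B - {i})" using i PB by (auto simp: R_def)
            then have "(y, z) \<in> swap_step M N B" using i z False PB by (auto simp: swap_step_def)
            then have "z \<in> P" using y unfolding P_def by auto
            then show False using z by (simp add: R_def)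
          qed
        qed
        then show "{i \<in> B. z \<notin> N (B - {i})} \<subseteq> B - R" by blast
      qed
    qed
    ultimately have "closed_set M N B R" by (simp add: closed_set_def)
    moreover have "s \<in> R" by (simp add: R_def P_def)
    ultimately show False using unblocked by blast
  qed
  then obtain t where t: "(s, t) \<in> (swap_step M N B)\<^sup>*" "t \<notin> M B" by (auto simp: P_def)
  then obtain n where "(s, t) \<in> swap_step M N B ^^ n" using rtrancl_imp_relpow by blast
  then show ?thesis using augment_path[OF MB NB s t(2)] that t(2) by blast
qed

text \<open>The condition on \<open>M\<close> is monotone in the set; the condition on
  \<open>N\<close> passes to unions by \<open>Inter_span\<close>. Hence there is a largest closed
  set, outside of which every uncaptured element can start an augmentation.\<close>

lemma closed_set_Union:
  assumes NB: "cl_indep N B" and F: "\<And>R. R \<in> F \<Longrightarrow> closed_set M N B R"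
  shows "closed_set M N B (\<Union>F)"
  unfolding closed_set_def
proof
  show "\<Union>F \<subseteq> M (B \<inter> \<Union>F)"
  proof
    fix y assume "y \<in> \<Union>F"
    then obtain R where R: "R \<in> F" "y \<in> R" by blast
    then have "y \<in> M (B \<inter> R)" using F by (auto simp: closed_set_def)
    then show "y \<in> M (B \<inter> \<Union>F)" by (rule M.monoD) (use R in blast)
  qed
  show "N B - \<Union>F \<subseteq> N (B - \<Union>F)"
  proof
    fix z assume z: "z \<in> N B - \<Union>F"
    have "z \<in> N (B \<inter> \<Inter>((\<lambda>R. B - R) ` F))"
    proof (rule N.Inter_span[OF NB])
      show "z \<in> N B" using z by blast
      fix X assume "X \<in> (\<lambda>R. B - R) ` F"
      then obtain R where "R \<in> F" "X = B - R" by blast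
      then show "X \<subseteq> B \<and> z \<in> N X" using F[of R] z by (auto simp: closed_set_def)
    qed
    then show "z \<in> N (B - \<Union>F)" by (rule N.monoD) blast
  qed
qed

text \<open>Here the roles are reversed, and \<open>Inter_span\<close> is applied in
  \<open>M\<close>. It provides the least closed set around given elements.\<close>

lemma closed_set_Inter:
  assumes MB: "cl_indep M B" and F: "\<And>R. R \<in> F \<Longrightarrow> closed_set M N B R" and ne: "F \<noteq> {}"
  shows "closed_set M N B (\<Inter>F)"
  unfolding closed_set_def
proof
  show "\<Inter>F \<subseteq> M (B \<inter> \<Inter>F)"
  proof
    fix y assume y: "y \<in> \<Inter>F"
    have yM: "y \<in> M (B \<inter> R)" if "R \<in> F" for R using F[OF that] y that by (auto simp: closed_set_def)
    have "y \<in> M (B \<inter> \<Inter>((\<lambda>R. B \<inter> R) ` F))"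
    proof (rule M.Inter_span[OF MB])
      obtain R where "R \<in> F" using ne by blast
      then show "y \<in> M B" by (rule M.monoD[OF yM]) blast
      fix X assume "X \<in> (\<lambda>R. B \<inter> R) ` F"
      then show "X \<subseteq> B \<and> y \<in> M X" using yM by blast
    qed
    then show "y \<in> M (B \<inter> \<Inter>F)" by (rule M.monoD) blast
  qed
  show "N B - \<Inter>F \<subseteq> N (B - \<Inter>F)"
  proof
    fix z assume z: "z \<in> N B - \<Inter>F"
    then obtain R where R: "R \<in> F" "z \<notin> R" by blast
    then have "z \<in> N (B - R)" using F[of R] z by (auto simp: closed_set_def)
    then show "z \<in> N (B - \<Inter>F)" by (rule N.monoD) (use R in blast)
  qed
qed

text \<open>\<open>W'\<close> need only be a wave once \<open>W\<close> is contracted in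
  \<open>M\<close>. On the side of \<open>N\<close>, \<open>B\<close> is independent even over all
  of \<open>- W\<close>, hence also over the part of \<open>B'\<close> outside
  \<open>W\<close>.\<close>

lemma rel_wave_Un:
  assumes W: "rel_wave M N I W B"
    and W': "B' \<subseteq> W'" "W' \<inter> I = {}" "W' \<subseteq> M (I \<union> W \<union> B')" "cl_indep (cl_contract N (- W')) B'"
  shows "rel_wave M N I (W \<union> W') (B \<union> (B' - W))"
proof -
  let ?Y = "- (W \<union> W')"
  have WM: "W \<subseteq> M (I \<union> (B \<union> (B' - W)))"
    using W M.mono[of "I \<union> B" "I \<union> (B \<union> (B' - W))"] by (auto simp: rel_wave_def)
  then have "I \<union> W \<union> B' \<subseteq> M (I \<union> (B \<union> (B' - W)))"
    using M.ext[of "I \<union> (B \<union> (B' - W))"] by blast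
  then have "M (I \<union> W \<union> B') \<subseteq> M (I \<union> (B \<union> (B' - W)))" by (rule M.le)
  then have "W' \<subseteq> M (I \<union> (B \<union> (B' - W)))" using W' by blast
  moreover have "cl_indep (cl_contract N ?Y) (B \<union> (B' - W))"
  proof -
    interpret Y: closure_matroid "cl_contract N ?Y" by (rule N.closure_matroid_contract)
    have "cl_indep (cl_contract N ?Y) B'"
      by (rule N.cl_indep_contract_mono[OF W'(4)]) (use N.ext[of "- W'"] in blast)
    then have 1: "cl_indep (cl_contract N ?Y) (B' - W)" by (rule Y.cl_indep_subset) blast
    have "cl_indep (cl_contract N ((B' - W) \<union> ?Y)) B"
      by (rule N.cl_indep_contract_mono[of "- W"]) (use W N.ext[of "- W"] in \<open>auto simp: rel_wave_def\<close>)
    then have "cl_indep (cl_contract (cl_contract N ?Y) (B' - W)) B" by (simp add: N.contract_contract)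
    then have "cl_indep (cl_contract N ?Y) ((B' - W) \<union> B)" by (rule Y.cl_indep_Un[OF 1])
    then show ?thesis by (simp add: Un_commute)
  qed
  ultimately show ?thesis using W W' WM by (auto simp: rel_wave_def)
qed

lemma max_rel_wave:
  obtains W B where "rel_wave M N I W B" "cl_indep (cl_contract M I) B"
    "\<And>W' B'. rel_wave M N I W' B' \<Longrightarrow> W' \<subseteq> W"
proof -
  text \<open>Zorn's lemma for the order \<open>W \<subseteq> W' \<and> B' \<inter> W = B\<close>, which becomes inclusion after encoding
    \<open>(W, B)\<close> as \<open>{(x, x \<in> B) | x. x \<in> W}\<close>.\<close>
  define tr where "tr S = {x. (x, True) \<in> S}" for S :: "('a \<times> bool) set"
  define A where "A = {S :: ('a \<times> bool) set. rel_wave M N I (fst ` S) (tr S) \<and> (\<forall>x. (x, True) \<in> S \<longrightarrow> (x, False) \<notin> S)}"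
  have "\<Union>C \<in> A" if C: "subset.chain A C" for C
  proof -
    have CA: "S \<in> A" if "S \<in> C" for S using C that by (auto simp: subset.chain_def)
    have lin: "S \<subseteq> T \<or> T \<subseteq> S" if "S \<in> C" "T \<in> C" for S T using C that by (auto simp: subset.chain_def)
    have f: "fst ` \<Union>C = (\<Union>S\<in>C. fst ` S)" "tr (\<Union>C) = (\<Union>S\<in>C. tr S)" by (auto simp: tr_def)
    have cons: "(x, False) \<notin> T" if "(x, True) \<in> S" "S \<in> C" "T \<in> C" for x S T
      using lin[OF that(2,3)] CA[OF that(2)] CA[OF that(3)] that(1) unfolding A_def by blast
    have WM: "fst ` S \<subseteq> M (I \<union> tr (\<Union>C))" if "S \<in> C" for S
      using CA[OF that] M.mono[of "I \<union> tr S" "I \<union> tr (\<Union>C)"] that f(2) unfolding A_def rel_wave_def by blast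
    have disj: "fst ` S \<inter> I = {}" if "S \<in> C" for S
      using CA[OF that] by (simp add: A_def rel_wave_def)
    have "cl_indep (cl_contract N (- fst ` \<Union>C)) (tr (\<Union>C))"
      unfolding cl_indep_def cl_contract_def
    proof (intro ballI notI)
      fix b assume b: "b \<in> tr (\<Union>C)" "b \<in> N (tr (\<Union>C) - {b} \<union> - fst ` \<Union>C)"
      then obtain S where S: "S \<in> C" "b \<in> tr S" using f by blast
      have "x \<in> tr S \<union> - fst ` S" if x: "x \<in> tr (\<Union>C)" for x
      proof -
        obtain T where T: "T \<in> C" "(x, True) \<in> T" using x by (auto simp: tr_def)
        have "(x, False) \<notin> S" using cons T S by blast
        then show ?thesis by (auto simp: tr_def) (metis (full_types))
      qed
      then have "tr (\<Union>C) - {b} \<union> - fst ` \<Union>C \<subseteq> (tr S - {b}) \<union> - fst ` S" using S by blast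
      then have "b \<in> N ((tr S - {b}) \<union> - fst ` S)" by (rule N.monoD[OF b(2)])
      moreover have "cl_indep (cl_contract N (- fst ` S)) (tr S)" using CA[OF S(1)] by (simp add: A_def rel_wave_def)
      ultimately show False using S by (simp add: cl_indep_def cl_contract_def)
    qed
    moreover have "tr (\<Union>C) \<subseteq> fst ` \<Union>C" by (force simp: tr_def)
    moreover have "fst ` \<Union>C \<inter> I = {}" unfolding f using disj by blast
    moreover have "fst ` \<Union>C \<subseteq> M (I \<union> tr (\<Union>C))" using WM unfolding f(1) by blast
    moreover have "\<forall>x. (x, True) \<in> \<Union>C \<longrightarrow> (x, False) \<notin> \<Union>C" using cons by blast
    ultimately show ?thesis by (simp add: A_def rel_wave_def)
  qed
  then obtain S where S: "S \<in> A" "\<And>T. T \<in> A \<Longrightarrow> S \<subseteq> T \<Longrightarrow> T = S" using subset_Zorn'[of A] by blast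
  define W where "W = fst ` S"
  define B where "B = tr S"
  have w: "rel_wave M N I W B" using S by (simp add: A_def W_def B_def)
  \<comment> \<open>A maximal wave is even the largest one: joining \<open>W'\<close> by
    \<open>rel_wave_Un\<close> keeps the witness unchanged on \<open>W\<close>, so it gives an
    extension in the order of Zorn's lemma.\<close>
  have max: "W' \<subseteq> W" if w': "rel_wave M N I W' B'" for W' B'
  proof -
    have "W' \<subseteq> M (I \<union> W \<union> B')"
      using w' M.mono[of "I \<union> B'" "I \<union> W \<union> B'"] by (auto simp: rel_wave_def)
    then have u: "rel_wave M N I (W \<union> W') (B \<union> (B' - W))"
      using w' by (intro rel_wave_Un[OF w]) (auto simp: rel_wave_def)
    define B2 where "B2 = B \<union> (B' - W)"
    define T where "T = B2 \<times> {True} \<union> (W \<union> W' - B2) \<times> {False}"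
    have B2: "B2 \<subseteq> W \<union> W'" using w w' by (auto simp: B2_def rel_wave_def)
    have "fst ` T = W \<union> W'"
    proof
      show "fst ` T \<subseteq> W \<union> W'" using B2 by (auto simp: T_def)
      show "W \<union> W' \<subseteq> fst ` T"
      proof
        fix x assume "x \<in> W \<union> W'"
        then have "(x, x \<in> B2) \<in> T" by (simp add: T_def)
        then show "x \<in> fst ` T" by (rule rev_image_eqI) simp
      qed
    qed
    moreover have "tr T = B2" by (auto simp: T_def tr_def)
    moreover have "\<forall>x. (x, True) \<in> T \<longrightarrow> (x, False) \<notin> T" by (auto simp: T_def)
    ultimately have "T \<in> A" using u by (simp add: A_def B2_def)
    moreover have "S \<subseteq> T"
    proof
      fix p assume p: "p \<in> S"
      obtain x b where xb: "p = (x, b)" by (cases p)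
      have "x \<in> W" using rev_image_eqI[OF p, of x fst] xb by (simp add: W_def)
      moreover have "b \<longleftrightarrow> x \<in> B" using p xb S(1) by (cases b) (auto simp: A_def B_def tr_def)
      ultimately show "p \<in> T" using xb by (auto simp: T_def B2_def)
    qed
    ultimately have "T = S" using S by blast
    then show ?thesis using \<open>fst ` T = W \<union> W'\<close> by (auto simp: W_def)
  qed
  \<comment> \<open>The witness is thinned to a basis over \<open>I\<close> in \<open>M\<close>;
    this keeps its span there and its independence in \<open>N\<close>.\<close>
  interpret I: closure_matroid "cl_contract M I" by (rule M.closure_matroid_contract)
  obtain B1 where B1: "B1 \<subseteq> B" "cl_indep (cl_contract M I) B1" "B \<subseteq> cl_contract M I B1" using I.basis by blast
  have "I \<union> B \<subseteq> M (I \<union> B1)"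
    using B1(3) M.ext[of "I \<union> B1"] unfolding cl_contract_def by (auto simp: Un_commute)
  then have "M (I \<union> B) \<subseteq> M (I \<union> B1)" by (rule M.le)
  moreover have "cl_indep (cl_contract N (- W)) B1"
    using w closure_matroid.cl_indep_subset[OF N.closure_matroid_contract _ B1(1)] by (simp add: rel_wave_def)
  ultimately have "rel_wave M N I W B1" using w B1(1) by (auto simp: rel_wave_def)
  then show ?thesis using that B1 max by blast
qed

text \<open>A wave of \<open>(M/I', N/I')\<close> can only fail to be \<open>N\<close>-spanned from the outside by its witness
  if an augmenting path inside it, or a set closed under alternating paths, contradicts the
  feasibility of \<open>I\<close>.\<close>

lemma wave_spanned:
  assumes feas: "feasible M N I" and MI': "M I' = M (insert t I)" and NI': "N I \<subseteq> N I'"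
    and w: "rel_wave M N I' W B" and B: "cl_indep (cl_contract M I') B"
  shows "W \<subseteq> N (- W \<union> B)"
proof (rule ccontr)
  assume "\<not> ?thesis"
  then obtain w where w0: "w \<in> W" "w \<notin> N (- W \<union> B)" by blast
  \<comment> \<open>\<open>W\<close> avoids \<open>I'\<close> but may meet \<open>I\<close>, the set
    whose feasibility is to be used. The elements of \<open>I\<close> lie in \<open>N (- W)\<close>,
    so moving them out of the wave does not affect the contraction in \<open>N\<close>.\<close>
  define V where "V = W - I"
  have WI': "I' \<subseteq> - W" and BW: "B \<subseteq> W" and WM: "W \<subseteq> M (I' \<union> B)" and NB: "cl_indep (cl_contract N (- W)) B"
    using w by (auto simp: rel_wave_def)
  have INW: "I \<subseteq> N (- W)" using NI' N.ext[of I] N.mono[OF WI'] by blast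
  have VW: "- V \<subseteq> N (- W)" using INW N.ext[of "- W"] by (auto simp: V_def)
  have BV: "B \<subseteq> V" using N.cl_indep_contract_disj[OF NB] INW BW by (auto simp: V_def)
  have "- V \<union> B \<subseteq> N (- W \<union> B)" using VW N.mono[of "- W" "- W \<union> B"] N.ext[of "- W \<union> B"] by blast
  then have wV: "w \<notin> N (- V \<union> B)" using w0 N.leD[of w "- V \<union> B" "- W \<union> B"] by blast
  then have wV': "w \<in> V" using N.mem[of w "- V \<union> B"] by blast
  define M1 where "M1 = cl_contract M I"
  define N1 where "N1 = cl_contract N (- V)"
  interpret P: closure_matroid_pair M1 N1
    unfolding M1_def N1_def by (intro closure_matroid_pair.intro M.closure_matroid_contract N.closure_matroid_contract)
  have "I \<subseteq> M I'" using MI' M.ext[of "insert t I"] by blast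
  then have MB: "cl_indep M1 B" unfolding M1_def by (rule M.cl_indep_contract_mono[OF B])
  have NB1: "cl_indep N1 B" unfolding N1_def by (rule N.cl_indep_contract_mono[OF NB VW])
  define U where "U = \<Union>{R. closed_set M1 N1 B R}"
  have U: "closed_set M1 N1 B U" unfolding U_def by (rule P.closed_set_Union[OF NB1]) blast
  have loops: "- V \<subseteq> N1 X" for X unfolding N1_def cl_contract_def using N.ext[of "X \<union> - V"] by blast
  show False
  proof (cases "\<exists>s. s \<notin> N1 B \<and> s \<notin> U")
    case True
    then obtain s where s: "s \<notin> N1 B" "s \<notin> U" by blast
    obtain B' t' where B': "cl_indep M1 B'" "cl_indep N1 B'" "t' \<in> B'" "t' \<notin> M1 B"
      "M1 B' = M1 (insert t' B)" "N1 B' = N1 (insert s B)"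
      by (rule P.augment[OF MB NB1 s(1)]) (use s(2) in \<open>auto simp: U_def\<close>)
    have B'V: "B' \<subseteq> V"
      using B'(2) N.cl_indep_contract_disj[of "- V" B'] N.ext[of "- V"] by (auto simp: N1_def)
    have "M (I' \<union> B) = M (insert t I \<union> B)" by (rule M.Un_cong[OF MI'])
    then have WM2: "W \<subseteq> M (insert t (B \<union> I))" using WM by (simp add: Un_commute)
    \<comment> \<open>Over \<open>I\<close>, the set \<open>I'\<close> contributes only
      \<open>t\<close> to the span in \<open>M\<close>, and the endpoint \<open>t'\<close> of the
      augmenting path can take its place. So \<open>B'\<close> witnesses a wave over
      \<open>I\<close>, and feasibility puts \<open>t'\<close> into \<open>M I\<close>.\<close>
    have "t' \<in> W" using B' B'V by (auto simp: V_def)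
    then have "t' \<in> M (insert t (B \<union> I))" using WM2 by blast
    moreover have "t' \<notin> M (B \<union> I)" using B'(4) by (simp add: M1_def cl_contract_def)
    ultimately have "t \<in> M (insert t' (B \<union> I))" by (rule M.exch)
    then have "insert t (B \<union> I) \<subseteq> M (insert t' (B \<union> I))" using M.ext[of "insert t' (B \<union> I)"] by blast
    then have "W \<subseteq> M (insert t' (B \<union> I))" using WM2 M.le by blast
    then have "W \<subseteq> M (I \<union> B')" using B'(5) by (simp add: M1_def cl_contract_def Un_commute)
    then have "rel_wave M N I V B'"
      using B'V B'(2) by (auto simp: rel_wave_def V_def N1_def)
    then have "V \<subseteq> M I" using feas by (auto simp: feasible_def)
    then have "t' \<in> M I" using B' B'V by blast
    then have "t' \<in> M (B \<union> I)" by (rule M.monoD) blast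
    then show False using B' by (simp add: M1_def cl_contract_def)
  next
    case False
    \<comment> \<open>Everything outside \<open>U\<close> is now spanned by \<open>B\<close> in
      \<open>N1\<close>. Closedness makes \<open>U \<inter> V\<close> a wave over \<open>I\<close>
      with witness \<open>B \<inter> U\<close>; feasibility then spans \<open>w\<close> from outside
      it, hence from \<open>- V\<close> and \<open>B\<close>.\<close>
    let ?R = "U \<inter> V"
    have wU: "w \<in> ?R" using False wV wV' by (auto simp: N1_def cl_contract_def Un_commute)
    have "U \<subseteq> M1 (B \<inter> U)" using U by (simp add: closed_set_def)
    moreover have "B \<inter> U = B \<inter> ?R" using BV by blast
    ultimately have UM: "?R \<subseteq> M (I \<union> B \<inter> ?R)" by (auto simp: M1_def cl_contract_def Un_commute)
    have "V - U \<subseteq> N1 (B - U)" using False U by (auto simp: closed_set_def)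
    then have VU: "- ?R \<subseteq> N (- V \<union> (B - ?R))"
    proof -
      assume a: "V - U \<subseteq> N1 (B - U)"
      have "B - U = B - ?R" using BV by blast
      then show ?thesis using a loops[of "B - U"] by (auto simp: N1_def cl_contract_def Un_commute)
    qed
    have "cl_indep (cl_contract N (- ?R)) (B \<inter> ?R)"
      unfolding cl_indep_def cl_contract_def
    proof (intro ballI notI)
      fix b assume b: "b \<in> B \<inter> ?R" "b \<in> N (B \<inter> ?R - {b} \<union> - ?R)"
      have "N (- V \<union> (B - ?R)) \<subseteq> N (B - {b} \<union> - V)" by (rule N.mono) (use b in auto)
      then have "B \<inter> ?R - {b} \<union> - ?R \<subseteq> N (B - {b} \<union> - V)"
        using VU N.ext[of "B - {b} \<union> - V"] by blast
      then have "b \<in> N (B - {b} \<union> - V)" by (rule N.leD[OF b(2)])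
      then show False using NB1 b by (simp add: cl_indep_def N1_def cl_contract_def)
    qed
    then have "rel_wave M N I ?R (B \<inter> ?R)" using UM by (auto simp: rel_wave_def V_def)
    then have "?R \<subseteq> N (- ?R)" using feas unfolding feasible_def by blast
    then have "w \<in> N (- ?R)" using wU by blast
    then have "w \<in> N (- V \<union> (B - ?R))" by (rule N.leD[OF _ VU])
    then have "w \<in> N (- V \<union> B)" by (rule N.monoD) blast
    then show False using wV by blast
  qed
qed

text \<open>An augmentation may create waves. Absorbing the witness of the largest one repairs this:
  a later wave can be joined to it, so it lies inside, where \<open>M\<close> is already spanned,
  and \<open>wave_spanned\<close> supplies the span in \<open>N\<close>.\<close>

lemma feasible_extend:
  assumes feas: "feasible M N I" and I': "cl_indep M I'" "cl_indep N I'"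
    and MI': "M I' = M (insert t I)" and NI': "N I \<subseteq> N I'"
  obtains C where "feasible M N (I' \<union> C)" "C \<inter> M I' = {}"
proof -
  obtain W B where w: "rel_wave M N I' W B" and MB: "cl_indep (cl_contract M I') B"
    and max: "\<And>W' B'. rel_wave M N I' W' B' \<Longrightarrow> W' \<subseteq> W"
    using max_rel_wave[of I'] by metis
  have span: "W \<subseteq> N (- W \<union> B)" by (rule wave_spanned[OF feas MI' NI' w MB])
  have WI': "I' \<subseteq> - W" and BW: "B \<subseteq> W" and WM: "W \<subseteq> M (I' \<union> B)" and NB: "cl_indep (cl_contract N (- W)) B"
    using w by (auto simp: rel_wave_def)
  have "cl_indep (cl_contract N I') B" by (rule N.cl_indep_contract_mono[OF NB]) (use WI' N.ext[of "- W"] in blast)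
  then have NI: "cl_indep N (I' \<union> B)" by (rule N.cl_indep_Un[OF I'(2)])
  have "W' \<subseteq> M (I' \<union> B) \<and> W' \<subseteq> N (- W')" if w': "rel_wave M N (I' \<union> B) W' B'" for W' B'
  proof -
    have 1: "I' \<union> B \<union> B' \<subseteq> I' \<union> W \<union> B'" using BW by blast
    have "W' \<subseteq> M (I' \<union> W \<union> B')" using w' M.mono[OF 1] by (auto simp: rel_wave_def)
    then have "rel_wave M N I' (W \<union> W') (B \<union> (B' - W))"
      using w' by (intro rel_wave_Un[OF w]) (auto simp: rel_wave_def)
    then have W'W: "W' \<subseteq> W" using max by blast
    then have "- W \<union> B \<subseteq> - W'" using w' by (auto simp: rel_wave_def)
    then have "W' \<subseteq> N (- W')" using span W'W N.mono[of "- W \<union> B" "- W'"] by blast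
    then show ?thesis using W'W WM by blast
  qed
  then have "feasible M N (I' \<union> B)"
    using NI M.cl_indep_Un[OF I'(1) MB] unfolding feasible_def by blast
  moreover have "B \<inter> M I' = {}" by (rule M.cl_indep_contract_disj[OF MB])
  ultimately show ?thesis by (rule that)
qed

section \<open>Augmentation by priority\<close>

definition blocked :: "'a set \<Rightarrow> 'a set" where
  "blocked B = \<Union>{R. closed_set M N B R}"

lemma closed_blocked: "cl_indep N B \<Longrightarrow> closed_set M N B (blocked B)"
  unfolding blocked_def by (rule closed_set_Union) auto

lemma blocked_upper: "closed_set M N B R \<Longrightarrow> R \<subseteq> blocked B"
  unfolding blocked_def by blast

text \<open>The augmentation takes place outside \<open>blocked I\<close>. The last property says that arcs of the
  exchange graph inside \<open>blocked I\<close> are never lost.\<close>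

lemma feasible_step:
  assumes feas: "feasible M N I" and s: "s \<notin> N I" "s \<notin> blocked I"
  obtains I' where "feasible M N I'" "I' \<inter> blocked I = I \<inter> blocked I" "N I \<subseteq> N I'" "s \<in> N I'"
    "\<And>V y. V \<subseteq> blocked I \<Longrightarrow> y \<in> N I \<Longrightarrow> y \<in> N (I' - V) \<Longrightarrow> y \<in> N (I - V)"
proof -
  define U where "U = blocked I"
  define B where "B = I - U"
  define Q where "Q = I \<inter> U"
  have MI: "cl_indep M I" and NI: "cl_indep N I" using feas by (auto simp: feasible_def)
  have U: "closed_set M N I U" unfolding U_def by (rule closed_blocked[OF NI])
  have IBQ: "I = B \<union> Q" "B \<inter> Q = {}" "Q \<subseteq> U" "B \<inter> U = {}" by (auto simp: B_def Q_def)
  have UQ: "U \<subseteq> M Q" using U by (simp add: closed_set_def Q_def)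
  have sU: "s \<notin> U" using s by (simp add: U_def)
  have sI: "s \<notin> I" using s N.mem[of s I] by blast
  \<comment> \<open>Contracting \<open>U\<close> in \<open>M\<close> and deleting it from
    \<open>N\<close> confines the augmentation to the outside of \<open>U\<close>. In
    \<open>M\<close> this amounts to contracting \<open>Q\<close>, which spans
    \<open>U\<close>.\<close>
  define M1 where "M1 = cl_contract M U"
  define N1 where "N1 = cl_restrict N U"
  interpret P: closure_matroid_pair M1 N1
    unfolding M1_def N1_def by (intro closure_matroid_pair.intro M.closure_matroid_contract N.closure_matroid_restrict)
  have N1eq: "N1 X = N X \<union> U" if "X \<inter> U = {}" for X
  proof -
    have "X - U = X" using that by blast
    then show ?thesis by (simp add: N1_def cl_restrict_def)
  qed
  have "cl_indep (cl_contract M Q) B" using M.cl_indep_contract_of_Un[of Q B] MI IBQ by (simp add: Un_commute Int_commute)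
  then have MB: "cl_indep M1 B" unfolding M1_def by (rule M.cl_indep_contract_mono[OF _ UQ])
  have NB: "cl_indep N1 B" unfolding N1_def N.cl_indep_restrict using N.cl_indep_subset[OF NI, of B] IBQ by blast
  have "N B \<subseteq> N I" by (rule N.mono) (use IBQ in blast)
  then have s1: "s \<notin> N1 B" using s sU N1eq[OF IBQ(4)] by blast
  \<comment> \<open>A closed set of the reduced pair, joined with \<open>U\<close>, is closed for
    \<open>I\<close> and thus contained in the largest closed set \<open>U\<close>.\<close>
  have nb: "s \<notin> R" if R: "closed_set M1 N1 B R" for R
  proof -
    have "closed_set M N I (R \<union> U)"
      unfolding closed_set_def
    proof
      have Q: "U \<subseteq> M (I \<inter> (R \<union> U))" using UQ M.mono[of Q "I \<inter> (R \<union> U)"] IBQ by blast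
      then have "(B \<inter> R) \<union> U \<subseteq> M (I \<inter> (R \<union> U))"
        using M.ext[of "I \<inter> (R \<union> U)"] IBQ by blast
      then have "M ((B \<inter> R) \<union> U) \<subseteq> M (I \<inter> (R \<union> U))" by (rule M.le)
      moreover have "R \<subseteq> M ((B \<inter> R) \<union> U)" using R by (simp add: closed_set_def M1_def cl_contract_def)
      ultimately show "R \<union> U \<subseteq> M (I \<inter> (R \<union> U))" using Q by blast
      show "N I - (R \<union> U) \<subseteq> N (I - (R \<union> U))"
      proof
        fix z assume z: "z \<in> N I - (R \<union> U)"
        have "z \<in> N B" using U z unfolding closed_set_def B_def by blast
        then have "z \<in> N1 (B - R)" using R z N1eq[OF IBQ(4)] unfolding closed_set_def by blast
        moreover have "(B - R) \<inter> U = {}" using IBQ by blast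
        ultimately have "z \<in> N (B - R)" using N1eq[of "B - R"] z by blast
        then show "z \<in> N (I - (R \<union> U))" by (rule N.monoD) (auto simp: B_def)
      qed
    qed
    then have "R \<union> U \<subseteq> U" unfolding U_def by (rule blocked_upper)
    then show ?thesis using sU by blast
  qed
  obtain B' t where B': "cl_indep M1 B'" "cl_indep N1 B'" "t \<in> B'" "t \<notin> M1 B" "M1 B' = M1 (insert t B)" "N1 B' = N1 (insert s B)"
    using P.augment[OF MB NB s1 nb] by metis
  have NB': "cl_indep N B'" and B'U: "B' \<inter> U = {}" using B'(2) by (auto simp: N1_def N.cl_indep_restrict)
  have sBU: "insert s B \<inter> U = {}" using IBQ sU by blast
  have eqU: "N B' \<union> U = N (insert s B) \<union> U"
    using B'(6) N1eq[OF B'U] N1eq[OF sBU] by simp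
  have NeqB: "N B' = N (insert s B)"
  proof (rule N.eqI)
    show "B' \<subseteq> N (insert s B)" using eqU B'U N.ext[of B'] by blast
    show "insert s B \<subseteq> N B'" using eqU sBU N.ext[of "insert s B"] by blast
  qed
  have MUQ: "M U = M Q" by (rule M.eqI[OF UQ]) (use IBQ M.ext[of U] in blast)
  define I1 where "I1 = B' \<union> Q"
  have MI1: "M I1 = M (insert t I)"
  proof -
    have "M (Q \<union> B') = M (U \<union> B')" by (rule M.Un_cong[OF MUQ[symmetric]])
    also have "\<dots> = M (U \<union> insert t B)" using B'(5) by (simp add: M1_def cl_contract_def Un_commute)
    also have "\<dots> = M (Q \<union> insert t B)" by (rule M.Un_cong[OF MUQ])
    finally show ?thesis by (simp add: I1_def IBQ(1) Un_commute)
  qed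
  have "cl_indep (cl_contract M Q) B'"
    by (rule M.cl_indep_contract_mono[OF B'(1)[unfolded M1_def]]) (use IBQ M.ext[of U] in blast)
  then have MI1': "cl_indep M I1"
    using M.cl_indep_Un[OF M.cl_indep_subset[OF MI, of Q]] IBQ by (simp add: I1_def Un_commute)
  have NsI: "cl_indep N (insert s I)" by (rule N.cl_indep_insert[OF NI s(1)])
  then have "cl_indep (cl_contract N (insert s B)) Q"
    using IBQ sI by (intro N.cl_indep_contract_of_Un) auto
  then have "cl_indep (cl_contract N B') Q"
    by (rule N.cl_indep_contract_mono) (use NeqB N.ext[of B'] in blast)
  then have NI1: "cl_indep N I1" unfolding I1_def by (rule N.cl_indep_Un[OF NB'])
  have "N (insert s B) \<subseteq> N I1" using NeqB N.mono[of B' I1] by (auto simp: I1_def)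
  then have sI1: "s \<in> N I1" "B \<subseteq> N I1" using N.ext[of "insert s B"] by auto
  then have "I \<subseteq> N I1" using IBQ N.ext[of I1] by (auto simp: I1_def)
  then have NII1: "N I \<subseteq> N I1" by (rule N.le)
  obtain C where C: "feasible M N (I1 \<union> C)" "C \<inter> M I1 = {}"
    by (rule feasible_extend[OF feas MI1' NI1 MI1 NII1])
  define I' where "I' = I1 \<union> C"
  have mono1: "N I1 \<subseteq> N I'" by (rule N.mono) (simp add: I'_def)
  have "U \<subseteq> M I1" using UQ M.mono[of Q I1] by (auto simp: I1_def)
  then have I'U: "I' \<inter> U = I \<inter> U" using C(2) B'U IBQ by (auto simp: I'_def I1_def)
  \<comment> \<open>\<open>Int_span\<close> is used twice. Inside \<open>I'\<close> it removes the
    repair set \<open>C\<close>, after which \<open>B'\<close> is replaced by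
    \<open>insert s B\<close>, a set disjoint from \<open>V\<close> with the same span in
    \<open>N\<close>. Inside \<open>insert s I\<close> it removes \<open>s\<close>.\<close>
  have last: "y \<in> N (I - V)" if V: "V \<subseteq> U" and y: "y \<in> N I" "y \<in> N (I' - V)" for V y
  proof -
    have NI': "cl_indep N I'" using C(1) by (auto simp: feasible_def I'_def)
    have y1: "y \<in> N I1" using NII1 y by blast
    have "y \<in> N (I1 \<inter> (I' - V))"
      by (rule N.Int_span[OF NI' _ _ y1 y(2)]) (auto simp: I'_def)
    then have y2: "y \<in> N (insert s I - V)"
    proof (rule N.leD)
      have "insert s B \<subseteq> insert s I - V" using IBQ V sU by blast
      then have "B' \<subseteq> N (insert s I - V)" using NeqB N.ext[of B'] N.mono[of "insert s B"] by blast
      moreover have "Q - V \<subseteq> N (insert s I - V)" using IBQ N.ext[of "insert s I - V"] by blast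
      ultimately show "I1 \<inter> (I' - V) \<subseteq> N (insert s I - V)" by (auto simp: I1_def)
    qed
    have "y \<in> N (I \<inter> (insert s I - V))"
      by (rule N.Int_span[OF NsI _ _ y(1) y2]) auto
    then show ?thesis by (rule N.monoD) blast
  qed
  show ?thesis
  proof (rule that)
    show "feasible M N I'" using C(1) by (simp add: I'_def)
    show "I' \<inter> blocked I = I \<inter> blocked I" using I'U by (simp add: U_def)
    show "N I \<subseteq> N I'" using NII1 mono1 by blast
    show "s \<in> N I'" using sI1 mono1 by blast
  qed (use last in \<open>simp add: U_def\<close>)
qed

text \<open>The last clause is the priority rule, with indices from an enumeration of the non-loops
  of \<open>N\<close>. It is phrased so as to hold vacuously once every uncaptured element is
  blocked, when the sequence may stay constant.\<close>

definition feasible_succ :: "'a set \<Rightarrow> 'a set \<Rightarrow> bool" where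
  "feasible_succ I I' \<longleftrightarrow> N I \<subseteq> N I' \<and> I' \<inter> blocked I = I \<inter> blocked I \<and>
    (\<forall>V y. V \<subseteq> blocked I \<longrightarrow> y \<in> N I \<longrightarrow> y \<in> N (I' - V) \<longrightarrow> y \<in> N (I - V)) \<and>
    (\<forall>z. z \<notin> N I \<longrightarrow> z \<notin> blocked I \<longrightarrow>
      (\<exists>s. s \<notin> N I \<and> s \<in> N I' \<and> to_nat_on (- N {}) s \<le> to_nat_on (- N {}) z))"

lemma feasible_succ_exists:
  assumes feas: "feasible M N I"
  shows "\<exists>I'. feasible M N I' \<and> feasible_succ I I'"
proof (cases "\<exists>s. s \<notin> N I \<and> s \<notin> blocked I")
  case True
  define p where "p s \<longleftrightarrow> s \<notin> N I \<and> s \<notin> blocked I" for s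
  define s where "s = arg_min (to_nat_on (- N {})) p"
  obtain s0 where s0: "p s0" using True by (auto simp: p_def)
  have ps: "p s" unfolding s_def by (rule arg_min_natI[where P = p, OF s0])
  have least: "to_nat_on (- N {}) s \<le> to_nat_on (- N {}) z" if "p z" for z
    unfolding s_def by (rule arg_min_nat_le[where P = p, OF that])
  have s: "s \<notin> N I" "s \<notin> blocked I" using ps by (auto simp: p_def)
  obtain I' where I': "feasible M N I'" "I' \<inter> blocked I = I \<inter> blocked I" "N I \<subseteq> N I'" "s \<in> N I'"
    "\<And>V y. V \<subseteq> blocked I \<Longrightarrow> y \<in> N I \<Longrightarrow> y \<in> N (I' - V) \<Longrightarrow> y \<in> N (I - V)"
    by (rule feasible_step[OF feas s]) (rule that)
  have "feasible_succ I I'" unfolding feasible_succ_def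
  proof (intro conjI allI impI)
    fix z assume "z \<notin> N I" "z \<notin> blocked I"
    then show "\<exists>s. s \<notin> N I \<and> s \<in> N I' \<and> to_nat_on (- N {}) s \<le> to_nat_on (- N {}) z"
      using s I'(4) least[of z] by (intro exI[of _ s]) (simp add: p_def)
  qed (use I' in auto)
  then show ?thesis using I'(1) by blast
next
  case False
  then show ?thesis using feas by (intro exI[of _ I]) (auto simp: feasible_succ_def)
qed

text \<open>Always augmenting from the first unblocked element, every element that is never captured is
  blocked from some stage on. The least closed sets \<open>R k\<close> around these elements increase with \<open>k\<close>
  while \<open>I k\<close> stabilises on them, so that their union is a wave witnessed by the limit of \<open>I k \<inter> R k\<close>.\<close>

lemma capture:
  assumes feas: "feasible M N {}" and fin: "cl_finitary N" and count: "countable (- N {})" and F: "finite F"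
  obtains I where "feasible M N I" "F \<subseteq> N I"
proof -
  have "\<exists>I. \<forall>n. feasible M N (I n) \<and> feasible_succ (I n) (I (Suc n))"
    by (rule dependent_nat_choice) (use feas feasible_succ_exists in auto)
  then obtain I :: "nat \<Rightarrow> 'a set" where fI: "feasible M N (I n)" and succ: "feasible_succ (I n) (I (Suc n))" for n
    by blast
  have MI: "cl_indep M (I n)" and NI: "cl_indep N (I n)" for n using fI[of n] by (auto simp: feasible_def)
  define U where "U n = blocked (I n)" for n
  have U: "closed_set M N (I n) (U n)" for n unfolding U_def by (rule closed_blocked[OF NI])
  have "N (I n) \<subseteq> N (I (Suc n))" for n using succ[of n] by (simp add: feasible_succ_def)
  then have Nmono: "N (I n) \<subseteq> N (I m)" if "n \<le> m" for n m
    using that by (rule lift_Suc_mono_le[of "\<lambda>n. N (I n)"])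
  define L where "L = (\<Union>n. N (I n))"
  define Z where "Z k = {z. z \<notin> L \<and> (\<forall>n\<ge>k. z \<in> U n)}" for k
  have ZU: "Z k \<subseteq> U k" and Zmono: "Z k \<subseteq> Z (Suc k)" for k by (auto simp: Z_def)
  \<comment> \<open>Each stage at which \<open>z\<close> is uncaptured and unblocked captures a new
    element of index at most that of \<open>z\<close>. These elements are distinct, so there are
    finitely many such stages.\<close>
  have evZ: "\<exists>k. z \<in> Z k" if z: "z \<notin> L" for z
  proof -
    define a where "a = to_nat_on (- N {})"
    define bad where "bad = {n. z \<notin> U n}"
    have "\<exists>s. s \<notin> N (I n) \<and> s \<in> N (I (Suc n)) \<and> a s \<le> a z" if "n \<in> bad" for n
      using succ[of n] that z by (auto simp: feasible_succ_def a_def bad_def U_def L_def)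
    then obtain s where s: "\<And>n. n \<in> bad \<Longrightarrow> s n \<notin> N (I n) \<and> s n \<in> N (I (Suc n)) \<and> a (s n) \<le> a z"
      by metis
    have ne: "s n \<noteq> s m" if "n \<in> bad" "m \<in> bad" "n < m" for n m
      using s[OF that(1)] s[OF that(2)] Nmono[of "Suc n" m] that(3) by auto
    have nl: "s n \<in> - N {}" if "n \<in> bad" for n
      using s[OF that] N.mono[of "{}" "I n"] by blast
    have "inj_on (\<lambda>n. a (s n)) bad"
    proof (rule inj_onI)
      fix n m assume nm: "n \<in> bad" "m \<in> bad" "a (s n) = a (s m)"
      then have "s n = s m" using inj_onD[OF inj_on_to_nat_on[OF count], of "s n" "s m"] nl by (simp add: a_def)
      then show "n = m" using ne[of n m] ne[of m n] nm by (cases n m rule: linorder_cases) auto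
    qed
    moreover have "(\<lambda>n. a (s n)) ` bad \<subseteq> {..a z}" using s by auto
    ultimately have "finite bad" by (meson finite_atMost finite_imageD finite_subset)
    then obtain k where "\<forall>n\<in>bad. n < k" using finite_nat_set_iff_bounded by blast
    then have "z \<in> Z k" using z by (auto simp: Z_def bad_def)
    then show ?thesis by blast
  qed
  define R where "R k = \<Inter>{R. closed_set M N (I k) R \<and> Z k \<subseteq> R}" for k
  have R: "closed_set M N (I k) (R k)" for k
    unfolding R_def by (rule closed_set_Inter[OF MI]) (use U ZU in auto)
  have ZR: "Z k \<subseteq> R k" for k unfolding R_def by blast
  have RU: "R k \<subseteq> U k" for k unfolding R_def using U[of k] ZU[of k] by blast
  have stab: "I (Suc k) \<inter> X = I k \<inter> X" if "X \<subseteq> U k" for k X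
    using succ[of k] that unfolding feasible_succ_def U_def by blast
  \<comment> \<open>By minimality of \<open>R k\<close> it suffices that the intersection with
    \<open>R (Suc k)\<close> is closed already at stage \<open>k\<close>. The condition on
    \<open>M\<close> holds because both stages agree on blocked sets; the condition on
    \<open>N\<close> needs the third clause of \<open>feasible_succ\<close>.\<close>
  have "R k \<subseteq> R (Suc k)" for k
  proof -
    define V where "V = R (Suc k) \<inter> R k"
    have VU: "V \<subseteq> U k" using RU by (auto simp: V_def)
    have "closed_set M N (I k) V" unfolding closed_set_def
    proof
      show "V \<subseteq> M (I k \<inter> V)"
      proof
        fix y assume y: "y \<in> V"
        have 1: "y \<in> M (I (Suc k) \<inter> R (Suc k))" using R[of "Suc k"] y by (auto simp: closed_set_def V_def)
        have 2: "y \<in> M (I (Suc k) \<inter> R k)" unfolding stab[OF RU] using R[of k] y by (auto simp: closed_set_def V_def)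
        have "y \<in> M (I (Suc k) \<inter> R (Suc k) \<inter> (I (Suc k) \<inter> R k))"
          by (rule M.Int_span[OF MI _ _ 1 2]) auto
        moreover have "I (Suc k) \<inter> R (Suc k) \<inter> (I (Suc k) \<inter> R k) = I k \<inter> V"
          using stab[OF VU] by (auto simp: V_def)
        ultimately show "y \<in> M (I k \<inter> V)" by simp
      qed
      show "N (I k) - V \<subseteq> N (I k - V)"
      proof
        fix y assume y: "y \<in> N (I k) - V"
        show "y \<in> N (I k - V)"
        proof (cases "y \<in> R k")
          case False
          then have "y \<in> N (I k - R k)" using R[of k] y by (auto simp: closed_set_def)
          then show ?thesis by (rule N.monoD) (auto simp: V_def)
        next
          case True
          then have "y \<notin> R (Suc k)" using y by (simp add: V_def)
          then have y1: "y \<in> N (I (Suc k) - R (Suc k))"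
            using R[of "Suc k"] Nmono[of k "Suc k"] y by (auto simp: closed_set_def)
          have "y \<in> N (I (Suc k) - V)" by (rule N.monoD[OF y1]) (auto simp: V_def)
          then show ?thesis using succ[of k] VU y unfolding feasible_succ_def U_def by blast
        qed
      qed
    qed
    moreover have "Z k \<subseteq> V" using ZR[of k] ZR[of "Suc k"] Zmono[of k] by (auto simp: V_def)
    ultimately have "R k \<subseteq> V" unfolding R_def by blast
    then show ?thesis by (simp add: V_def)
  qed
  then have Rmono: "R k \<subseteq> R m" if "k \<le> m" for k m using that by (rule lift_Suc_mono_le[of R])
  have IR: "I k \<inter> R k \<subseteq> I m" if "k \<le> m" for k m
    using that
  proof (induction m rule: dec_induct)
    case (step m)
    have "R k \<subseteq> U m" using Rmono[of k m] RU[of m] step by blast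
    then show ?case using stab[of "R k" m] step.IH by blast
  qed simp
  define RR where "RR = (\<Union>k. R k)"
  define J where "J = (\<Union>k. I k \<inter> R k)"
  have RM: "R k \<subseteq> M J" for k
    using R[of k] M.mono[of "I k \<inter> R k" J] unfolding closed_set_def J_def by blast
  have LR: "- RR \<subseteq> L"
  proof
    fix z assume z: "z \<in> - RR"
    show "z \<in> L"
    proof (rule ccontr)
      assume "z \<notin> L"
      then obtain k where "z \<in> Z k" using evZ by blast
      then show False using ZR[of k] z by (auto simp: RR_def)
    qed
  qed
  \<comment> \<open>A dependence would by finitariness occur at one stage, since elements outside
    \<open>RR\<close> are captured at some stage. There, closedness of \<open>R k\<close> spans
    those elements by \<open>I k - R k\<close>, so the dependence would lie inside the independent
    set \<open>I k\<close>.\<close>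
  have "cl_indep (cl_contract N (- RR)) J"
    unfolding cl_indep_def cl_contract_def
  proof (intro ballI notI)
    fix b assume b: "b \<in> J" "b \<in> N (J - {b} \<union> - RR)"
    define X where "X n = (I n \<inter> R n - {b}) \<union> (N (I n) - RR)" for n
    have Xmono: "X n \<subseteq> X m" if "n \<le> m" for n m
      using IR[OF that] Rmono[OF that] Nmono[OF that] unfolding X_def by blast
    have "b \<in> N (\<Union>n. X n)"
      by (rule N.monoD[OF b(2)]) (use LR in \<open>auto simp: X_def J_def L_def\<close>)
    then obtain n where n: "b \<in> N (X n)" using N.cl_finitary_UN[where X = X, OF fin Xmono] by blast
    obtain m where m: "b \<in> I m \<inter> R m" using b by (auto simp: J_def)
    define k where "k = max n m"
    have bk: "b \<in> I k \<inter> R k" using m IR[of m k] Rmono[of m k] by (auto simp: k_def)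
    have "N (X n) \<subseteq> N (X k)" by (rule N.mono[OF Xmono]) (simp add: k_def)
    then have bX: "b \<in> N (X k)" using n by blast
    have "N (I k) - RR \<subseteq> N (I k - R k)" using R[of k] by (auto simp: closed_set_def RR_def)
    also have "\<dots> \<subseteq> N (I k - {b})" by (rule N.mono) (use bk in blast)
    finally have "X k \<subseteq> N (I k - {b})" using N.ext[of "I k - {b}"] by (auto simp: X_def)
    then have "b \<in> N (I k - {b})" by (rule N.leD[OF bX])
    then show False using N.cl_indepD[OF NI, of b k] bk by blast
  qed
  then have "rel_wave M N {} RR J" using RM by (auto simp: rel_wave_def RR_def J_def)
  \<comment> \<open>Feasibility of the empty set spans \<open>RR\<close> from captured elements
    only, and \<open>L\<close> is closed in \<open>N\<close>. So every element is captured.\<close>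
  then have RRN: "RR \<subseteq> N (- RR)" using feas unfolding feasible_def by blast
  have "N L \<subseteq> L"
  proof
    fix x assume "x \<in> N L"
    then obtain n where "x \<in> N (N (I n))" unfolding L_def using N.cl_finitary_UN[where X = "\<lambda>n. N (I n)", OF fin Nmono] by blast
    then show "x \<in> L" using N.idem[of "I n"] by (auto simp: L_def)
  qed
  then have "RR \<subseteq> L" using RRN N.mono[OF LR] by blast
  then have LU: "L = UNIV" using LR by blast
  have "\<exists>n. F \<subseteq> N (I n)" using F
  proof (induction F)
    case (insert x F)
    then obtain n where n: "F \<subseteq> N (I n)" by blast
    obtain m where m: "x \<in> N (I m)" using LU by (auto simp: L_def)
    then show ?case using n Nmono[of n "max n m"] Nmono[of m "max n m"] by (intro exI[of _ "max n m"]) auto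
  qed simp
  then show ?thesis using that fI by blast
qed

end

section \<open>Wave-free minors\<close>

text \<open>\<open>I\<close> is contracted and \<open>J\<close> is deleted. The condition \<open>N (- J) = UNIV\<close> says that \<open>J\<close> is independent
  in the dual of \<open>N\<close>.\<close>

definition wave_free :: "('a set \<Rightarrow> 'a set) \<Rightarrow> ('a set \<Rightarrow> 'a set) \<Rightarrow> 'a set \<Rightarrow> 'a set \<Rightarrow> bool" where
  "wave_free M N I J \<longleftrightarrow> I \<inter> J = {} \<and> cl_indep M I \<and> N (- J) = UNIV \<and>
    (\<forall>W B. B \<subseteq> W \<longrightarrow> W \<inter> (I \<union> J) = {} \<longrightarrow> W \<subseteq> M (I \<union> B) \<longrightarrow>
      cl_indep (cl_contract N (- (J \<union> W))) B \<longrightarrow> W = {})"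

lemma wave_freeI:
  assumes "I \<inter> J = {}" "cl_indep M I" "N (- J) = UNIV"
    and "\<And>W B. B \<subseteq> W \<Longrightarrow> W \<inter> (I \<union> J) = {} \<Longrightarrow> W \<subseteq> M (I \<union> B) \<Longrightarrow>
      cl_indep (cl_contract N (- (J \<union> W))) B \<Longrightarrow> W = {}"
  shows "wave_free M N I J"
  using assms unfolding wave_free_def by simp

lemma wave_freeD:
  assumes "wave_free M N I J" "B \<subseteq> W" "W \<inter> (I \<union> J) = {}" "W \<subseteq> M (I \<union> B)"
    "cl_indep (cl_contract N (- (J \<union> W))) B"
  shows "W = {}"
proof -
  have "\<forall>W B. B \<subseteq> W \<longrightarrow> W \<inter> (I \<union> J) = {} \<longrightarrow> W \<subseteq> M (I \<union> B) \<longrightarrow>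
      cl_indep (cl_contract N (- (J \<union> W))) B \<longrightarrow> W = {}" using assms(1) by (simp add: wave_free_def)
  then show ?thesis using assms(2-5) by (elim allE[of _ W] allE[of _ B]) simp
qed

context closure_matroid_pair
begin

lemma closure_matroid_pair_dual: "closure_matroid_pair (cl_dual N) (cl_dual M)"
  by (intro closure_matroid_pair.intro M.closure_matroid_dual N.closure_matroid_dual)

lemma cl_indep_iff_dual: "cl_indep M I \<longleftrightarrow> cl_dual M (- I) = UNIV"
  using closure_matroid.cl_indep_dual[OF M.closure_matroid_dual, of I] by (simp add: M.dual_dual)

text \<open>The complement \<open>W - B\<close> turns a witness for the dual pair into one for the
  original pair: dual independence of \<open>B\<close> becomes spanning in \<open>M\<close>, and
  dual spanning becomes independence in \<open>N\<close>.\<close>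

lemma wave_free_dual:
  assumes st: "wave_free M N I J" shows "wave_free (cl_dual N) (cl_dual M) J I"
proof -
  have st': "I \<inter> J = {}" "cl_indep M I" "N (- J) = UNIV" using st by (auto simp: wave_free_def)
  show ?thesis
  proof (rule wave_freeI)
    show "J \<inter> I = {}" using st' by blast
    show "cl_indep (cl_dual N) J" using st' by (simp add: N.cl_indep_dual)
    show "cl_dual M (- I) = UNIV" using st' cl_indep_iff_dual by simp
    fix W B assume W: "B \<subseteq> W" "W \<inter> (J \<union> I) = {}" "W \<subseteq> cl_dual N (J \<union> B)"
      "cl_indep (cl_contract (cl_dual M) (- (I \<union> W))) B"
    have "W \<subseteq> M (I \<union> (W - B))"
    proof
      fix b assume b: "b \<in> W"
      show "b \<in> M (I \<union> (W - B))"
      proof (cases "b \<in> B")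
        case True
        then have "b \<notin> cl_dual M (B - {b} \<union> - (I \<union> W))" using W(4) by (simp add: cl_indep_def cl_contract_def)
        then have "b \<in> M (- (B - {b} \<union> - (I \<union> W)) - {b})" unfolding cl_dual_def by blast
        moreover have "- (B - {b} \<union> - (I \<union> W)) - {b} = I \<union> (W - B)" using W True by blast
        ultimately show ?thesis by (simp only:)
      next
        case False
        then show ?thesis using b by (intro M.mem) blast
      qed
    qed
    moreover have "cl_indep (cl_contract N (- (J \<union> W))) (W - B)"
      unfolding cl_indep_def cl_contract_def
    proof
      fix b assume b: "b \<in> W - B"
      then have "b \<in> cl_dual N (J \<union> B)" "b \<notin> J \<union> B" using W by auto
      then have "b \<notin> N (- (J \<union> B) - {b})" unfolding cl_dual_def by blast
      moreover have "- (J \<union> B) - {b} = W - B - {b} \<union> - (J \<union> W)" using W b by blast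
      ultimately show "b \<notin> N (W - B - {b} \<union> - (J \<union> W))" by (simp only: not_False_eq_True)
    qed
    ultimately show "W = {}"
      using wave_freeD[OF st, of "W - B" W] W(2) by (simp add: Un_commute)
  qed
qed

text \<open>In the largest wave \<open>W\<close>, the set \<open>K\<close> given by the condition is
  contracted and the rest deleted; a remaining wave would enlarge \<open>W\<close>. The common loops
  form a wave with empty witness, so they are decided here too.\<close>

lemma initial_wave_free:
  assumes cond: "\<And>W B. rel_wave M N {} W B \<Longrightarrow> \<exists>K \<subseteq> W. cl_indep M K \<and> W \<subseteq> N (K \<union> - W)"
  obtains I J where "wave_free M N I J" "M {} \<inter> N {} \<subseteq> I \<union> J"
proof -
  obtain W B where w: "rel_wave M N {} W B" and max: "\<And>W' B'. rel_wave M N {} W' B' \<Longrightarrow> W' \<subseteq> W"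
    using max_rel_wave[of "{}"] by metis
  obtain K where K: "K \<subseteq> W" "cl_indep M K" "W \<subseteq> N (K \<union> - W)" using cond[OF w] by blast
  have eq: "- (W - K) = K \<union> - W" using K by blast
  have no_wave: "W' = {}" if W': "B' \<subseteq> W'" "W' \<inter> (K \<union> (W - K)) = {}" "W' \<subseteq> M (K \<union> B')"
    "cl_indep (cl_contract N (- (W - K \<union> W'))) B'" for W' B'
  proof -
    let ?W = "W - K \<union> W'"
    have "M (K \<union> B') \<subseteq> M (W \<union> B')" by (rule M.mono) (use K in blast)
    then have "?W \<subseteq> M ({} \<union> W \<union> B')" using W'(3) M.ext[of "W \<union> B'"] by auto
    then have "rel_wave M N {} (W \<union> ?W) (B \<union> (B' - W))"
      using W' by (intro rel_wave_Un[OF w]) auto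
    then have "W \<union> ?W \<subseteq> W" by (rule max)
    then show ?thesis using W'(2) by blast
  qed
  have "wave_free M N K (W - K)"
  proof (rule wave_freeI)
    show "N (- (W - K)) = UNIV" unfolding eq using K(3) N.ext[of "K \<union> - W"] by blast
  qed (use K(2) no_wave in auto)
  moreover have "rel_wave M N {} (M {} \<inter> N {}) {}" by (simp add: rel_wave_def cl_indep_def)
  then have "M {} \<inter> N {} \<subseteq> K \<union> (W - K)" using max by blast
  ultimately show ?thesis by (rule that)
qed

section \<open>Passing between wave-free pairs and feasible sets of the minor\<close>

lemma closure_matroid_pair_minor: "closure_matroid_pair (cl_minor M I J) (cl_minor N I J)"
  unfolding cl_minor_def
  by (intro closure_matroid_pair.intro closure_matroid.closure_matroid_restrict M.closure_matroid_contract N.closure_matroid_contract)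

text \<open>Decided elements are loops of both minors, so waves may contain them. What is left of a
  wave after removing them is a wave in the sense of \<open>wave_free\<close>, hence empty.\<close>

lemma wave_free_feasible:
  assumes st: "wave_free M N I J"
  shows "feasible (cl_minor M I J) (cl_minor N I J) {}"
proof -
  interpret P: closure_matroid_pair "cl_minor M I J" "cl_minor N I J" by (rule closure_matroid_pair_minor)
  have IJ: "I \<inter> J = {}" using st by (simp add: wave_free_def)
  have "W \<subseteq> I \<union> J" if w: "rel_wave (cl_minor M I J) (cl_minor N I J) {} W B" for W B
  proof -
    have BW: "B \<subseteq> W" and WM: "W \<subseteq> cl_minor M I J B" and iB: "cl_indep (cl_contract (cl_minor N I J) (- W)) B"
      using w by (auto simp: rel_wave_def)
    have BIJ: "B \<inter> (I \<union> J) = {}" using P.N.cl_indep_contract_disj[OF iB] N.minor_loops[of I J "- W"] by blast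
    let ?W = "W - (I \<union> J)"
    have "cl_indep (cl_contract N (- (J \<union> ?W))) B"
      unfolding cl_indep_def cl_contract_def
    proof (intro ballI notI)
      fix b assume b: "b \<in> B" "b \<in> N (B - {b} \<union> - (J \<union> ?W))"
      have "b \<in> N ((B - {b} \<union> - W) - J \<union> I)"
        by (rule N.monoD[OF b(2)]) (use BIJ in blast)
      then have "b \<in> cl_contract (cl_minor N I J) (- W) (B - {b})"
        by (simp add: cl_contract_def cl_minor_def cl_restrict_def)
      then show False using iB b(1) by (simp add: cl_indep_def)
    qed
    moreover have "B \<inter> J = {}" using BIJ by blast
    then have "?W \<subseteq> M (I \<union> B)" using WM M.minor_eq[of B J I] by (auto simp: Un_commute)
    moreover have "B \<subseteq> ?W" "?W \<inter> (I \<union> J) = {}" using BW BIJ by auto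
    ultimately have "?W = {}" by (intro wave_freeD[OF st, of B ?W])
    then show ?thesis by blast
  qed
  then show ?thesis unfolding feasible_def
    using P.M.cl_indep_empty P.N.cl_indep_empty M.minor_loops[of I J "{}"] N.minor_loops[of I J] by blast
qed

text \<open>Undecided elements spanned by \<open>I0\<close> in the minor of \<open>M\<close> would
  form a wave with empty witness, so they are deleted as \<open>J0\<close>. Feasibility of
  \<open>I0\<close> says that the rest still spans them in \<open>N\<close>. A wave \<open>W\<close>
  left over gives the wave \<open>W \<union> J0\<close> over \<open>I0\<close>, which forces
  \<open>W\<close> into \<open>J0\<close>.\<close>

lemma wave_free_extend:
  assumes st: "wave_free M N I J" and feas: "feasible (cl_minor M I J) (cl_minor N I J) I0"
  obtains J' where "wave_free M N (I \<union> I0) J'" "J \<subseteq> J'"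
proof -
  interpret P: closure_matroid_pair "cl_minor M I J" "cl_minor N I J" by (rule closure_matroid_pair_minor)
  have IJ: "I \<inter> J = {}" and NJ: "N (- J) = UNIV" and MI: "cl_indep M I" using st by (auto simp: wave_free_def)
  have "cl_indep (cl_minor M I J) I0" using feas by (simp add: feasible_def)
  then have cI0: "cl_indep (cl_contract M I) I0" and I0J: "I0 \<inter> J = {}"
    unfolding cl_minor_def closure_matroid.cl_indep_restrict[OF M.closure_matroid_contract] by auto
  have I0I: "I0 \<inter> I = {}" using M.cl_indep_contract_disj[OF cI0] M.ext[of I] by blast
  define J0 where "J0 = cl_minor M I J I0 - (I0 \<union> I \<union> J)"
  have "rel_wave (cl_minor M I J) (cl_minor N I J) I0 J0 {}" by (auto simp: rel_wave_def J0_def cl_indep_def)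
  then have "J0 \<subseteq> cl_minor N I J (- J0)" using feas unfolding feasible_def by blast
  moreover have "- J0 - J \<union> I = - (J \<union> J0)" using IJ by (auto simp: J0_def)
  ultimately have "J0 \<subseteq> N (- (J \<union> J0))" by (auto simp: cl_minor_def cl_restrict_def cl_contract_def J0_def)
  then have "- J \<subseteq> N (- (J \<union> J0))" using N.ext[of "- (J \<union> J0)"] by blast
  then have "N (- (J \<union> J0)) = UNIV" using N.le NJ by blast
  moreover have "cl_indep M (I \<union> I0)" by (rule M.cl_indep_Un[OF MI cI0])
  moreover have "(I \<union> I0) \<inter> (J \<union> J0) = {}" using IJ I0J by (auto simp: J0_def)
  moreover have "W = {}" if W: "B \<subseteq> W" "W \<inter> (I \<union> I0 \<union> (J \<union> J0)) = {}" "W \<subseteq> M (I \<union> I0 \<union> B)"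
    "cl_indep (cl_contract N (- (J \<union> J0 \<union> W))) B" for W B
  proof -
    have BJ: "(I0 \<union> B) \<inter> J = {}" using W I0J by blast
    have "cl_indep (cl_contract (cl_minor N I J) (- (W \<union> J0))) B"
      unfolding cl_indep_def cl_contract_def
    proof (intro ballI notI)
      fix b assume b: "b \<in> B" "b \<in> cl_minor N I J (B - {b} \<union> - (W \<union> J0))"
      then have b2: "b \<in> N ((B - {b} \<union> - (W \<union> J0)) - J \<union> I)" using BJ by (auto simp: cl_minor_def cl_restrict_def cl_contract_def)
      have "b \<in> N (B - {b} \<union> - (J \<union> J0 \<union> W))"
        by (rule N.monoD[OF b2]) (use W IJ in \<open>auto simp: J0_def\<close>)
      then show False using W(4) b(1) by (simp add: cl_indep_def cl_contract_def)
    qed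
    moreover have "W \<subseteq> cl_minor M I J (I0 \<union> B)"
      using W(3) M.minor_eq[OF BJ, of I] by (auto simp: Un_ac)
    moreover have "J0 \<subseteq> cl_minor M I J (I0 \<union> B)"
      using P.M.mono[of I0 "I0 \<union> B"] by (auto simp: J0_def)
    ultimately have "rel_wave (cl_minor M I J) (cl_minor N I J) I0 (W \<union> J0) B"
      using W(1,2) by (auto simp: rel_wave_def J0_def)
    then have "W \<subseteq> cl_minor M I J I0" using feas unfolding feasible_def by blast
    then have "W \<subseteq> J0" using W(2) by (auto simp: J0_def)
    then show ?thesis using W(2) by blast
  qed
  ultimately have "wave_free M N (I \<union> I0) (J \<union> J0)" by (intro wave_freeI)
  then show ?thesis by (rule that) simp
qed

text \<open>Since \<open>- J\<close> spans everything in \<open>N\<close>, finitariness provides a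
  finite set of undecided elements that spans \<open>e\<close> over \<open>I\<close>; it is enough
  to capture that set in the minor.\<close>

lemma wave_free_capture:
  assumes st: "wave_free M N I J" and fin: "cl_finitary N" and count: "countable (- (I \<union> J))"
  obtains I' J' where "wave_free M N I' J'" "I \<subseteq> I'" "J \<subseteq> J'" "e \<in> N I'"
proof -
  interpret P: closure_matroid_pair "cl_minor M I J" "cl_minor N I J" by (rule closure_matroid_pair_minor)
  have NJ: "N (- J) = UNIV" and IJ: "I \<inter> J = {}" using st by (auto simp: wave_free_def)
  have "(- J - I) \<union> I = - J" using IJ by blast
  then have "e \<in> cl_contract N I (- J - I)" using NJ by (simp add: cl_contract_def)
  then obtain F where F: "F \<subseteq> - J - I" "finite F" "e \<in> cl_contract N I F" by (rule cl_finitaryE[OF N.cl_finitary_contract[OF fin]])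
  have fin': "cl_finitary (cl_minor N I J)"
    unfolding cl_minor_def by (intro closure_matroid.cl_finitary_restrict N.closure_matroid_contract N.cl_finitary_contract fin)
  have "- cl_minor N I J {} \<subseteq> - (I \<union> J)" using N.minor_loops[of I J "{}"] by blast
  then have "countable (- cl_minor N I J {})" using count by (rule countable_subset)
  then obtain I0 where I0: "feasible (cl_minor M I J) (cl_minor N I J) I0" "F \<subseteq> cl_minor N I J I0"
    using P.capture[OF wave_free_feasible[OF st] fin' _ F(2)] by metis
  obtain J' where J': "wave_free M N (I \<union> I0) J'" "J \<subseteq> J'" by (rule wave_free_extend[OF st I0(1)])
  have "F \<subseteq> N (I0 - J \<union> I)" using I0(2) F(1) by (auto simp: cl_minor_def cl_restrict_def cl_contract_def)
  also have "\<dots> \<subseteq> N (I \<union> I0)" by (rule N.mono) blast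
  finally have "F \<union> I \<subseteq> N (I \<union> I0)" using N.ext[of "I \<union> I0"] by blast
  moreover have "e \<in> N (F \<union> I)" using F(3) by (simp add: cl_contract_def)
  ultimately have "e \<in> N (I \<union> I0)" by (rule N.leD[rotated])
  then show ?thesis using that J' by blast
qed

text \<open>An element of \<open>N I\<close> can be deleted, as the remaining elements span it in
  \<open>N\<close> anyway. Any other \<open>e\<close> is a loop of neither minor, since a loop in
  \<open>M\<close> would be a one-element wave; it is contracted, and \<open>feasible_extend\<close>
  repairs the waves thereby created.\<close>

lemma wave_free_decide:
  assumes st: "wave_free M N I J"
  obtains I' J' where "wave_free M N I' J'" "I \<subseteq> I'" "J \<subseteq> J'" "e \<in> I' \<union> J'"
proof (cases "e \<in> I \<union> J")
  case True
  then show ?thesis using that st by blast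
next
  case False
  have NJ: "N (- J) = UNIV" and IJ: "I \<inter> J = {}" using st by (auto simp: wave_free_def)
  show ?thesis
  proof (cases "e \<in> N I")
    case True
    have eN: "- X \<subseteq> N (- insert e X)" if "I \<inter> X = {}" for X
    proof -
      have "N I \<subseteq> N (- insert e X)" by (rule N.mono) (use that False in blast)
      then have "insert e (- insert e X) \<subseteq> N (- insert e X)"
        using True N.ext[of "- insert e X"] by (meson insert_subset subsetD)
      then show ?thesis by blast
    qed
    have "N (- insert e J) = UNIV" using N.le[OF eN[OF IJ]] NJ by blast
    moreover have "W = {}" if W: "B \<subseteq> W" "W \<inter> (I \<union> insert e J) = {}" "W \<subseteq> M (I \<union> B)"
      "cl_indep (cl_contract N (- (insert e J \<union> W))) B" for W B
    proof -
      have "cl_indep (cl_contract N (- (J \<union> W))) B"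
        by (rule N.cl_indep_contract_mono[OF W(4)]) (use eN[of "J \<union> W"] IJ W in auto)
      then show ?thesis using wave_freeD[OF st W(1) _ W(3)] W(2) by blast
    qed
    moreover have "I \<inter> insert e J = {}" "cl_indep M I" using IJ False st by (auto simp: wave_free_def)
    ultimately have "wave_free M N I (insert e J)" by (intro wave_freeI)
    then show ?thesis using that by blast
  next
    case eN: False
    interpret P: closure_matroid_pair "cl_minor M I J" "cl_minor N I J" by (rule closure_matroid_pair_minor)
    have "e \<notin> M I"
    proof
      assume "e \<in> M I"
      then have "{e} \<subseteq> M (I \<union> {})" by simp
      moreover have "{e} \<inter> (I \<union> J) = {}" using False by blast
      moreover have "cl_indep (cl_contract N (- (J \<union> {e}))) {}" by (simp add: cl_indep_def)
      ultimately show False using wave_freeD[OF st, of "{}" "{e}"] by blast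
    qed
    then have e: "e \<notin> cl_minor M I J {}" "e \<notin> cl_minor N I J {}" using eN False by (simp_all add: M.minor_eq N.minor_eq)
    obtain C where C: "feasible (cl_minor M I J) (cl_minor N I J) ({e} \<union> C)"
    proof (rule P.feasible_extend[OF wave_free_feasible[OF st]])
      show "cl_indep (cl_minor M I J) {e}" by (rule P.M.cl_indep_insert[OF P.M.cl_indep_empty e(1)])
      show "cl_indep (cl_minor N I J) {e}" by (rule P.N.cl_indep_insert[OF P.N.cl_indep_empty e(2)])
      show "cl_minor N I J {} \<subseteq> cl_minor N I J {e}" by (rule P.N.mono) simp
    qed (auto intro: that)
    obtain J' where "wave_free M N (I \<union> ({e} \<union> C)) J'" "J \<subseteq> J'" by (rule wave_free_extend[OF st C])
    then show ?thesis using that by blast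
  qed
qed

lemma wave_free_stage:
  assumes st: "wave_free M N I J" and count: "countable (- (I \<union> J))"
  shows "\<exists>I' J'. wave_free M N I' J' \<and> I \<subseteq> I' \<and> J \<subseteq> J' \<and> e \<in> I' \<union> J' \<and>
    (cl_finitary N \<longrightarrow> e \<in> N I') \<and> (cl_finitary (cl_dual M) \<longrightarrow> e \<in> cl_dual M J')"
proof -
  interpret D: closure_matroid_pair "cl_dual N" "cl_dual M" by (rule closure_matroid_pair_dual)
  obtain I1 J1 where 1: "wave_free M N I1 J1" "I \<subseteq> I1" "J \<subseteq> J1" "e \<in> I1 \<union> J1" by (rule wave_free_decide[OF st])
  have c1: "countable (- (I1 \<union> J1))" by (rule countable_subset[OF _ count]) (use 1 in blast)
  obtain I2 J2 where 2: "wave_free M N I2 J2" "I1 \<subseteq> I2" "J1 \<subseteq> J2" "cl_finitary N \<longrightarrow> e \<in> N I2"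
  proof (cases "cl_finitary N")
    case True
    show ?thesis by (rule wave_free_capture[OF 1(1) True c1]) (use that in blast)
  qed (use that 1 in blast)
  have c2: "countable (- (J2 \<union> I2))" by (rule countable_subset[OF _ c1]) (use 2 in blast)
  obtain I3 J3 where 3: "wave_free M N I3 J3" "I2 \<subseteq> I3" "J2 \<subseteq> J3" "cl_finitary (cl_dual M) \<longrightarrow> e \<in> cl_dual M J3"
  proof (cases "cl_finitary (cl_dual M)")
    case True
    obtain J' I' where "wave_free (cl_dual N) (cl_dual M) J' I'" "J2 \<subseteq> J'" "I2 \<subseteq> I'" "e \<in> cl_dual M J'"
      by (rule D.wave_free_capture[OF wave_free_dual[OF 2(1)] True c2])
    moreover from this have "wave_free M N I' J'"
      using D.wave_free_dual[of J' I'] by (simp add: M.dual_dual N.dual_dual)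
    ultimately show ?thesis using that by blast
  qed (use that 2 in blast)
  have "N I2 \<subseteq> N I3" by (rule N.mono[OF 3(2)])
  then show ?thesis using 1 2 3 by (intro exI[of _ I3] exI[of _ J3]) blast
qed

lemma wave_free_limit:
  assumes st: "wave_free M N I0 J0" and count: "countable (- (I0 \<union> J0))"
    and M: "cl_finitary M \<or> cl_finitary (cl_dual M)" and N: "cl_finitary N \<or> cl_finitary (cl_dual N)"
  shows "\<exists>I. cl_indep M I \<and> N I = UNIV"
proof -
  interpret D: closure_matroid_pair "cl_dual N" "cl_dual M" by (rule closure_matroid_pair_dual)
  define E where "E = - (I0 \<union> J0)"
  define ok where "ok p \<longleftrightarrow> wave_free M N (fst p) (snd p) \<and> I0 \<subseteq> fst p \<and> J0 \<subseteq> snd p" for p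
  define nxt where "nxt e p q \<longleftrightarrow> fst p \<subseteq> fst q \<and> snd p \<subseteq> snd q \<and> e \<in> fst q \<union> snd q \<and>
    (cl_finitary N \<longrightarrow> e \<in> N (fst q)) \<and> (cl_finitary (cl_dual M) \<longrightarrow> e \<in> cl_dual M (snd q))" for e p q
  have "\<exists>f. \<forall>n. ok (f n) \<and> nxt (from_nat_into E n) (f n) (f (Suc n))"
  proof (rule dependent_nat_choice)
    show "\<exists>p. ok p" using st by (intro exI[of _ "(I0, J0)"]) (simp add: ok_def)
    fix p n assume p: "ok p"
    then have "countable (- (fst p \<union> snd p))" by (intro countable_subset[OF _ count]) (auto simp: ok_def)
    then obtain I' J' where "wave_free M N I' J'" "fst p \<subseteq> I'" "snd p \<subseteq> J'" "from_nat_into E n \<in> I' \<union> J'"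
      "cl_finitary N \<longrightarrow> from_nat_into E n \<in> N I'" "cl_finitary (cl_dual M) \<longrightarrow> from_nat_into E n \<in> cl_dual M J'"
      using wave_free_stage[of "fst p" "snd p" "from_nat_into E n"] p unfolding ok_def by blast
    then show "\<exists>q. ok q \<and> nxt (from_nat_into E n) p q"
      using p by (intro exI[of _ "(I', J')"]) (auto simp: ok_def nxt_def)
  qed
  then obtain f where ok: "\<And>n. ok (f n)" and nxt: "\<And>n. nxt (from_nat_into E n) (f n) (f (Suc n))" by blast
  have Imono: "fst (f m) \<subseteq> fst (f n)" and Jmono: "snd (f m) \<subseteq> snd (f n)" if "m \<le> n" for m n
    using that nxt lift_Suc_mono_le[of "\<lambda>n. fst (f n)" m n] lift_Suc_mono_le[of "\<lambda>n. snd (f n)" m n]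
    unfolding nxt_def by auto
  define I where "I = (\<Union>n. fst (f n))"
  define J where "J = (\<Union>n. snd (f n))"
  have surj: "\<exists>n. from_nat_into E n = e" if "e \<in> E" for e
    using from_nat_into_surj[of E e] that count by (simp add: E_def)
  have fI: "fst (f n) \<subseteq> I" and fJ: "snd (f n) \<subseteq> J" for n by (auto simp: I_def J_def)
  have I0: "I0 \<subseteq> I" and J0: "J0 \<subseteq> J" using ok[of 0] fI[of 0] fJ[of 0] by (auto simp: ok_def)
  have all: "I \<union> J = UNIV"
  proof -
    have "e \<in> I \<union> J" if e: "e \<in> E" for e
    proof -
      obtain n where "from_nat_into E n = e" using surj[OF e] by blast
      then show ?thesis using nxt[of n] fI[of "Suc n"] fJ[of "Suc n"] by (auto simp: nxt_def)
    qed
    then show ?thesis using I0 J0 by (auto simp: E_def)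
  qed
  have disj: "I \<inter> J = {}"
  proof -
    have "x \<notin> snd (f m)" if "x \<in> fst (f n)" for x n m
      using that ok[of "max n m"] Imono[of n "max n m"] Jmono[of m "max n m"]
      by (auto simp: ok_def wave_free_def)
    then show ?thesis by (auto simp: I_def J_def)
  qed
  have "N I = UNIV"
  proof (cases "cl_finitary N")
    case True
    have "E \<subseteq> N I"
    proof
      fix e assume "e \<in> E"
      then obtain n where "from_nat_into E n = e" using surj by blast
      then show "e \<in> N I" using nxt[of n] True N.mono[OF fI[of "Suc n"]] by (auto simp: nxt_def)
    qed
    \<comment> \<open>Elements of \<open>J0\<close> need no stage of their own, because
      \<open>- J0\<close> spans everything.\<close>
    then have "- J0 \<subseteq> N I" using I0 N.ext[of I] by (auto simp: E_def)
    then show ?thesis using st N.le[of "- J0" I] by (auto simp: wave_free_def)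
  next
    case False
    then have fin: "cl_finitary (cl_dual N)" using N by blast
    have "cl_indep (cl_dual N) J"
      unfolding J_def
    proof (rule D.M.cl_indep_UN[OF fin])
      show "cl_indep (cl_dual N) (snd (f n))" for n using ok[of n] by (simp add: ok_def wave_free_def N.cl_indep_dual)
    qed (use Jmono in blast)
    then have "N (- J) = UNIV" by (simp add: N.cl_indep_dual)
    moreover have "- J = I" using all disj by blast
    ultimately show ?thesis by simp
  qed
  moreover have "cl_indep M I"
  proof (cases "cl_finitary (cl_dual M)")
    case True
    have "E \<subseteq> cl_dual M J"
    proof
      fix e assume "e \<in> E"
      then obtain n where "from_nat_into E n = e" using surj by blast
      then show "e \<in> cl_dual M J" using nxt[of n] True D.N.mono[OF fJ[of "Suc n"]] by (auto simp: nxt_def)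
    qed
    then have "- I0 \<subseteq> cl_dual M J" using J0 D.N.ext[of J] by (auto simp: E_def)
    moreover have "cl_dual M (- I0) = UNIV" using st cl_indep_iff_dual by (simp add: wave_free_def)
    ultimately have "cl_dual M J = UNIV" using D.N.le[of "- I0" J] by auto
    moreover have "J = - I" using all disj by blast
    ultimately show ?thesis using cl_indep_iff_dual by simp
  next
    case False
    then have fin: "cl_finitary M" using M by blast
    show ?thesis unfolding I_def
    proof (rule M.cl_indep_UN[OF fin])
      show "cl_indep M (fst (f n))" for n using ok[of n] by (simp add: ok_def wave_free_def)
    qed (use Imono in blast)
  qed
  ultimately show ?thesis by blast
qed

end

section \<open>Matroid kernels\<close>

text \<open>These elements are rejected by the greedy choice from \<open>X\<close> along
  \<open>r\<close>. Comparing with all earlier elements, not just the accepted ones, makes the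
  operator monotone in \<open>X\<close>.\<close>

definition dominated :: "('a set \<Rightarrow> 'a set) \<Rightarrow> ('a \<times> 'a) set \<Rightarrow> 'a set \<Rightarrow> 'a set" where
  "dominated c r X = {e \<in> X. e \<in> c (X \<inter> {x. (x, e) \<in> r})}"

lemma finite_has_last:
  assumes "finite S" "S \<noteq> {}" "trans r" "\<And>x y. x \<noteq> y \<Longrightarrow> (x, y) \<in> r \<or> (y, x) \<in> r"
  shows "\<exists>m\<in>S. \<forall>x\<in>S - {m}. (x, m) \<in> r"
  using assms(1,2)
proof (induction S rule: finite_ne_induct)
  case (insert x F)
  then obtain m where m: "m \<in> F" "\<forall>y\<in>F - {m}. (y, m) \<in> r" by blast
  show ?case
  proof (cases "(x, m) \<in> r")
    case True
    then show ?thesis using m by blast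
  next
    case False
    then have "(m, x) \<in> r" using assms(4)[of x m] insert m by blast
    then have "(y, x) \<in> r" if "y \<in> F" for y
      using m that transD[OF assms(3), of y m x] by (cases "y = m") auto
    then show ?thesis by blast
  qed
qed simp

context closure_matroid
begin

lemma dominated_mono: "X \<subseteq> Y \<Longrightarrow> dominated c r X \<subseteq> dominated c r Y"
  using mono[of "X \<inter> {x. (x, e) \<in> r}" "Y \<inter> {x. (x, e) \<in> r}" for e] unfolding dominated_def by blast

text \<open>In a finite set of undominated elements the last one is not spanned by the others, so
  the set is independent by induction; finitariness extends this to infinite sets. Spanning follows
  by well-founded induction along \<open>r\<close>.\<close>

lemma undominated_basis_finitary:
  assumes fin: "cl_finitary c" and r: "wf r" "trans r" "\<And>x y. x \<noteq> y \<Longrightarrow> (x, y) \<in> r \<or> (y, x) \<in> r"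
  shows "cl_indep c (X - dominated c r X)" "X \<subseteq> c (X - dominated c r X)"
proof -
  let ?C = "X - dominated c r X"
  have fin_indep: "cl_indep c S" if "finite S" "S \<subseteq> ?C" for S
    using that
  proof (induction S rule: finite_psubset_induct)
    case (psubset S)
    show ?case
    proof (cases "S = {}")
      case False
      then obtain m where m: "m \<in> S" "\<forall>x\<in>S - {m}. (x, m) \<in> r"
        using finite_has_last[OF psubset.hyps(1) _ r(2,3)] by blast
      have "S - {m} \<subset> S" "S - {m} \<subseteq> ?C" using psubset.prems m(1) by auto
      then have "cl_indep c (S - {m})" by (rule psubset.IH)
      moreover have "m \<notin> c (S - {m})"
      proof
        assume a: "m \<in> c (S - {m})"
        have "m \<in> c (X \<inter> {x. (x, m) \<in> r})" by (rule monoD[OF a]) (use m psubset.prems in blast)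
        then show False using m psubset.prems by (auto simp: dominated_def)
      qed
      ultimately have "cl_indep c (insert m (S - {m}))" by (rule cl_indep_insert)
      then show ?thesis using m by (simp add: insert_absorb)
    qed (simp add: cl_indep_empty)
  qed
  show "cl_indep c ?C" unfolding cl_indep_def
  proof (intro ballI notI)
    fix x assume x: "x \<in> ?C" "x \<in> c (?C - {x})"
    obtain F where F: "F \<subseteq> ?C - {x}" "finite F" "x \<in> c F" by (rule cl_finitaryE[OF fin x(2)])
    then have "cl_indep c (insert x F)" using x by (intro fin_indep) auto
    then show False using F cl_indep_insertD[of x F] by blast
  qed
  have "e \<in> X \<longrightarrow> e \<in> c ?C" for e
  proof (induction e rule: wf_induct_rule[OF r(1)])
    case (1 e)
    show ?case
    proof
      assume e: "e \<in> X"
      show "e \<in> c ?C"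
      proof (cases "e \<in> dominated c r X")
        case True
        then have e2: "e \<in> c (X \<inter> {x. (x, e) \<in> r})" by (simp add: dominated_def)
        show ?thesis by (rule leD[OF e2]) (use 1 in blast)
      next
        case False
        then show ?thesis using e by (intro mem) blast
      qed
    qed
  qed
  then show "X \<subseteq> c ?C" by blast
qed

text \<open>For cofinitary matroids greedy choice runs backwards: the dominated elements form the
  greedy basis of the dual of the restriction to \<open>X\<close>.\<close>

lemma undominated_basis_cofinitary:
  assumes fin: "cl_finitary (cl_dual c)" and r: "wf (r\<inverse>)" "trans r" "\<And>x y. x \<noteq> y \<Longrightarrow> (x, y) \<in> r \<or> (y, x) \<in> r"
  shows "cl_indep c (X - dominated c r X)" "X \<subseteq> c (X - dominated c r X)"
proof -
  define D where "D = dominated c r X"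
  define d where "d = cl_contract (cl_dual c) (- X)"
  interpret dual: closure_matroid "cl_dual c" by (rule closure_matroid_dual)
  interpret d: closure_matroid d unfolding d_def by (rule dual.closure_matroid_contract)
  have find: "cl_finitary d" unfolding d_def by (rule dual.cl_finitary_contract[OF fin])
  have irr: "(x, x) \<notin> r" for x using wf_not_refl[OF r(1), of x] by simp
  have asym: "(y, x) \<notin> r" if "(x, y) \<in> r" for x y using transD[OF r(2) that, of x] irr by blast
  have "e \<in> d (X \<inter> {x. (x, e) \<in> r\<inverse>}) \<longleftrightarrow> e \<notin> c (X \<inter> {x. (x, e) \<in> r})" if e: "e \<in> X" for e
  proof -
    have "- (X \<inter> {x. (x, e) \<in> r\<inverse>} \<union> - X) - {e} = X \<inter> {x. (x, e) \<in> r}"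
      using r(3) irr asym by blast
    moreover have "e \<notin> X \<inter> {x. (x, e) \<in> r\<inverse>} \<union> - X" using e irr by blast
    ultimately show ?thesis unfolding d_def cl_contract_def cl_dual_def by auto
  qed
  then have eq: "X - dominated d (r\<inverse>) X = D" by (auto simp: dominated_def D_def)
  have tot: "(x, y) \<in> r\<inverse> \<or> (y, x) \<in> r\<inverse>" if "x \<noteq> y" for x y using r(3)[OF that] by blast
  have Di: "cl_indep d D" and XD: "X \<subseteq> d D"
    using d.undominated_basis_finitary[OF find r(1) _ tot, of X] r(2) unfolding eq by auto
  have DX: "D \<subseteq> X" by (auto simp: D_def dominated_def)
  show "cl_indep c (X - dominated c r X)"
    unfolding cl_indep_def D_def[symmetric]
  proof
    fix e assume e: "e \<in> X - D"
    then have "e \<in> cl_dual c (D \<union> - X)" using XD by (auto simp: d_def cl_contract_def)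
    then have "e \<notin> c (- (D \<union> - X) - {e})" using e unfolding cl_dual_def by blast
    moreover have "- (D \<union> - X) - {e} = X - D - {e}" by blast
    ultimately show "e \<notin> c (X - D - {e})" by (simp only: not_False_eq_True)
  qed
  have "e \<in> c (X - D)" if e: "e \<in> D" for e
  proof -
    have "e \<notin> cl_dual c (D - {e} \<union> - X)" using Di e by (simp add: cl_indep_def d_def cl_contract_def)
    then have "e \<in> c (- (D - {e} \<union> - X) - {e})" unfolding cl_dual_def by blast
    moreover have "- (D - {e} \<union> - X) - {e} = X - D" using e by blast
    ultimately show ?thesis by (simp only:)
  qed
  then show "X \<subseteq> c (X - dominated c r X)"
    unfolding D_def[symmetric] using ext[of "X - D"] by blast
qed

text \<open>\<open>A\<close> has to be an initial segment of \<open>r\<close>, so that no element of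
  an independent \<open>A\<close> is ever dominated. The finitary case needs \<open>r\<close>
  well-founded, the cofinitary case its converse; both orders come from a well-order sorted first by
  membership in \<open>A\<close>.\<close>

lemma greedy_order:
  assumes "cl_finitary c \<or> cl_finitary (cl_dual c)"
  obtains r where "\<And>X. cl_indep c (X - dominated c r X)" "\<And>X. X \<subseteq> c (X - dominated c r X)"
    "\<And>x e. (x, e) \<in> r \<Longrightarrow> e \<in> A \<Longrightarrow> x \<in> A - {e}"
proof -
  obtain w :: "('a \<times> 'a) set" where w: "well_order_on UNIV w" using well_order_on by blast
  define s where "s = w - Id"
  have s: "wf s" "trans s" "\<And>x y. x \<noteq> y \<Longrightarrow> (x, y) \<in> s \<or> (y, x) \<in> s"
    using w trans_diff_Id[of w]
    by (auto simp: s_def well_order_on_def linear_order_on_def partial_order_on_def preorder_on_def total_on_def)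
  have irr: "(x, x) \<notin> s" for x by (simp add: s_def)
  define q where "q (g :: 'a \<Rightarrow> nat) = inv_image (less_than <*lex*> s) (\<lambda>x. (g x, x))" for g
  have q: "wf (q g)" "trans (q g)" for g
    unfolding q_def by (intro wf_inv_image wf_lex_prod wf_less_than s trans_inv_image trans_lex_prod trans_less_than)+
  have tot: "(x, y) \<in> q g \<or> (y, x) \<in> q g" if "x \<noteq> y" for x y g
    using s(3)[OF that] by (auto simp: q_def)
  show ?thesis
  proof (cases "cl_finitary c")
    case True
    let ?r = "q (\<lambda>x. if x \<in> A then 0 else 1)"
    show ?thesis
    proof (rule that)
      show "cl_indep c (X - dominated c ?r X)" "X \<subseteq> c (X - dominated c ?r X)" for X
        using undominated_basis_finitary[OF True q tot] by auto
      show "x \<in> A - {e}" if "(x, e) \<in> ?r" "e \<in> A" for x e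
        using that irr by (auto simp: q_def split: if_splits)
    qed
  next
    case False
    then have fin: "cl_finitary (cl_dual c)" using assms by blast
    \<comment> \<open>Here \<open>A\<close> comes last in the well-order and therefore first in its
      converse.\<close>
    let ?r = "(q (\<lambda>x. if x \<in> A then 1 else 0))\<inverse>"
    have r: "wf (?r\<inverse>)" "trans ?r" "\<And>x y. x \<noteq> y \<Longrightarrow> (x, y) \<in> ?r \<or> (y, x) \<in> ?r"
      using q tot by auto
    show ?thesis
    proof (rule that)
      show "cl_indep c (X - dominated c ?r X)" "X \<subseteq> c (X - dominated c ?r X)" for X
        using undominated_basis_cofinitary[OF fin r] by auto
      show "x \<in> A - {e}" if "(x, e) \<in> ?r" "e \<in> A" for x e
        using that irr by (auto simp: q_def split: if_splits)
    qed
  qed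
qed

end

context closure_matroid_pair
begin

text \<open>The fixed point below is a matroid kernel in the sense of Fleiner: \<open>M\<close> prefers the elements
  of \<open>I\<close>, and \<open>N\<close> prefers those of \<open>J\<close>.\<close>

lemma common_basis:
  assumes M: "cl_finitary M \<or> cl_finitary (cl_dual M)" and N: "cl_finitary N \<or> cl_finitary (cl_dual N)"
    and I: "cl_indep M I" "N I = UNIV" and J: "cl_indep N J" "M J = UNIV"
  shows "\<exists>K. cl_indep M K \<and> M K = UNIV \<and> cl_indep N K \<and> N K = UNIV"
proof -
  obtain r where r: "\<And>X. cl_indep M (X - dominated M r X)" "\<And>X. X \<subseteq> M (X - dominated M r X)"
    "\<And>x e. (x, e) \<in> r \<Longrightarrow> e \<in> I \<Longrightarrow> x \<in> I - {e}" using M.greedy_order[OF M, of I] by blast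
  obtain s where s: "\<And>X. cl_indep N (X - dominated N s X)" "\<And>X. X \<subseteq> N (X - dominated N s X)"
    "\<And>x e. (x, e) \<in> s \<Longrightarrow> e \<in> J \<Longrightarrow> x \<in> J - {e}" using N.greedy_order[OF N, of J] by blast
  \<comment> \<open>Deferred acceptance: \<open>N\<close> is offered what \<open>M\<close> does not
    reject from \<open>X\<close>, and \<open>f X\<close> is what \<open>N\<close> does not reject
    from this offer. Both halves reverse inclusion, so \<open>f\<close> is monotone.\<close>
  define f where "f X = - dominated N s (- dominated M r X)" for X
  have "mono f"
  proof (rule monoI)
    fix X Y :: "'a set" assume "X \<subseteq> Y"
    then have "- dominated M r Y \<subseteq> - dominated M r X" using M.dominated_mono[of X Y r] by blast
    then show "f X \<subseteq> f Y"
      unfolding f_def using N.dominated_mono[of "- dominated M r Y" "- dominated M r X" s] by blast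
  qed
  then have fixed: "lfp f = f (lfp f)" by (rule lfp_unfold)
  define X where "X = lfp f"
  have "X = f X" unfolding X_def by (rule fixed)
  then have X: "X = - dominated N s (- dominated M r X)" unfolding f_def .
  define Y where "Y = - dominated M r X"
  have XY: "X = - dominated N s Y" using X by (simp add: Y_def)
  define K where "K = X \<inter> Y"
  have K1: "K = X - dominated M r X" by (auto simp: K_def Y_def)
  have K2: "K = Y - dominated N s Y" using XY by (auto simp: K_def)
  \<comment> \<open>An element of \<open>J\<close> rejected by \<open>N\<close> would be spanned by
    earlier elements, all of them in \<open>J\<close>, against independence. So \<open>J\<close>
    lies in \<open>X\<close>, which \<open>K\<close> spans in \<open>M\<close>; symmetrically,
    \<open>I\<close> lies in \<open>Y\<close>.\<close>
  have "J \<subseteq> M K"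
  proof
    fix e assume e: "e \<in> J"
    have "e \<notin> dominated N s Y"
    proof
      assume "e \<in> dominated N s Y"
      then have e1: "e \<in> N (Y \<inter> {x. (x, e) \<in> s})" by (simp add: dominated_def)
      have "e \<in> N (J - {e})" by (rule N.monoD[OF e1]) (use s(3) e in blast)
      then show False using N.cl_indepD[OF J(1) e] by blast
    qed
    then show "e \<in> M K" using XY r(2)[of X] by (auto simp: K1)
  qed
  moreover have "I \<subseteq> N K"
  proof
    fix e assume e: "e \<in> I"
    have "e \<notin> dominated M r X"
    proof
      assume "e \<in> dominated M r X"
      then have e1: "e \<in> M (X \<inter> {x. (x, e) \<in> r})" by (simp add: dominated_def)
      have "e \<in> M (I - {e})" by (rule M.monoD[OF e1]) (use r(3) e in blast)
      then show False using M.cl_indepD[OF I(1) e] by blast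
    qed
    then show "e \<in> N K" using s(2)[of Y] by (auto simp: K2 Y_def)
  qed
  ultimately have "M K = UNIV" "N K = UNIV" using M.le[of J K] N.le[of I K] I J by auto
  moreover have "cl_indep M K" "cl_indep N K" using r(1)[of X] s(1)[of Y] by (simp_all add: K1[symmetric] K2[symmetric])
  ultimately show ?thesis by blast
qed

end

section \<open>From independent sets to closure operators\<close>

definition matroid_closure :: "'a matroid \<Rightarrow> 'a set \<Rightarrow> 'a set" where
  "matroid_closure M X = - ground M \<union>
    {x \<in> ground M. x \<in> X \<or> (\<exists>I \<subseteq> X. I \<in> indep M \<and> insert x I \<notin> indep M)}"

lemma maximal_inD:
  assumes "maximal_in F X"
  shows "X \<in> F" "\<And>Y. Y \<in> F \<Longrightarrow> X \<subseteq> Y \<Longrightarrow> Y = X"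
  using assms by (auto simp: maximal_in_def)

lemma maximal_inI: "X \<in> F \<Longrightarrow> (\<And>Y. Y \<in> F \<Longrightarrow> X \<subseteq> Y \<Longrightarrow> Y = X) \<Longrightarrow> maximal_in F X"
  by (auto simp: maximal_in_def)

locale infinite_matroid =
  fixes M :: "'a matroid"
  assumes matroid: "matroid M"
begin

lemma indep_ground: "I \<in> indep M \<Longrightarrow> I \<subseteq> ground M"
  using matroid by (auto simp: matroid_def)

lemma indep_empty: "{} \<in> indep M"
  using matroid by (simp add: matroid_def)

lemma indep_subset: "J \<in> indep M \<Longrightarrow> I \<subseteq> J \<Longrightarrow> I \<in> indep M"
  using matroid by (auto simp: matroid_def)

lemma indep_exchange:
  assumes "I \<in> indep M" "\<not> maximal_in (indep M) I" "maximal_in (indep M) J"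
  obtains e where "e \<in> J - I" "insert e I \<in> indep M"
proof -
  have "\<forall>I\<in>indep M. \<forall>J\<in>indep M. maximal_in (indep M) J \<and> \<not> maximal_in (indep M) I \<longrightarrow>
      (\<exists>e\<in>J - I. insert e I \<in> indep M)" using matroid by (simp add: matroid_def)
  then have "\<exists>e\<in>J - I. insert e I \<in> indep M"
    using assms maximal_inD(1)[OF assms(3)] by simp
  then show ?thesis using that by blast
qed

lemma indep_extend:
  assumes "I \<in> indep M" "I \<subseteq> X" "X \<subseteq> ground M"
  obtains J where "I \<subseteq> J" "maximal_in (indep M \<inter> Pow X) J"
proof -
  have "\<forall>X. X \<subseteq> ground M \<longrightarrow> (\<forall>I\<in>indep M \<inter> Pow X. \<exists>J. I \<subseteq> J \<and> maximal_in (indep M \<inter> Pow X) J)"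
    using matroid by (simp add: matroid_def)
  then have "\<exists>J. I \<subseteq> J \<and> maximal_in (indep M \<inter> Pow X) J" using assms by simp
  then show ?thesis using that by blast
qed

text \<open>The exchange axiom speaks only of bases of the whole matroid; this transfers it to
  restrictions. If it failed, \<open>I\<close> and \<open>insert x I\<close> would both extend to
  bases using only elements of \<open>B - X\<close>, the second missing some \<open>b\<close> of the
  first. Exchanging \<open>b\<close> out of \<open>B\<close> would then bring in an element of
  \<open>X\<close>, against the maximality of \<open>J\<close>.\<close>

lemma restrict_exchange:
  assumes X: "X \<subseteq> ground M" and J: "maximal_in (indep M \<inter> Pow X) J"
    and I: "I \<subseteq> X" and x: "x \<in> X - I" "insert x I \<in> indep M"
  obtains e where "e \<in> J - I" "insert e I \<in> indep M"
proof (rule ccontr)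
  assume "\<not> thesis"
  then have none: "insert e I \<notin> indep M" if "e \<in> J - I" for e
    using that \<open>\<And>e. e \<in> J - I \<Longrightarrow> insert e I \<in> indep M \<Longrightarrow> thesis\<close> by metis
  have Ji: "J \<in> indep M" "J \<subseteq> X" using maximal_inD(1)[OF J] by auto
  have Ii: "I \<in> indep M" by (rule indep_subset[OF x(2)]) blast
  obtain B where B: "J \<subseteq> B" "maximal_in (indep M \<inter> Pow (ground M)) B"
    using indep_extend[OF Ji(1) _ subset_refl] indep_ground[OF Ji(1)] by blast
  have "indep M \<inter> Pow (ground M) = indep M" using indep_ground by blast
  then have Bm: "maximal_in (indep M) B" using B(2) by simp
  have Bi: "B \<in> indep M" by (rule maximal_inD(1)[OF Bm])
  have "B \<inter> X \<in> indep M \<inter> Pow X" using indep_subset[OF Bi, of "B \<inter> X"] by blast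
  then have BX: "B \<inter> X = J" using maximal_inD(2)[OF J] B(1) Ji(2) by blast
  have IBX: "I \<union> (B - X) \<subseteq> ground M" using X I indep_ground[OF Bi] by blast
  obtain I' where I': "I \<subseteq> I'" "maximal_in (indep M \<inter> Pow (I \<union> (B - X))) I'"
    by (rule indep_extend[OF Ii _ IBX]) auto
  have I'i: "I' \<in> indep M" "I' \<subseteq> I \<union> (B - X)" using maximal_inD(1)[OF I'(2)] by auto
  have I'm: "maximal_in (indep M) I'"
  proof (rule ccontr)
    assume "\<not> maximal_in (indep M) I'"
    then obtain e where e: "e \<in> B - I'" "insert e I' \<in> indep M" using indep_exchange[OF I'i(1) _ Bm] by blast
    show False
    proof (cases "e \<in> X")
      case True
      have "insert e I \<in> indep M" by (rule indep_subset[OF e(2)]) (use I' in blast)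
      then show False using none[of e] True e BX I' by blast
    next
      case False
      then have "insert e I' = I'" using maximal_inD(2)[OF I'(2), of "insert e I'"] e I'i(2) by blast
      then show False using e by blast
    qed
  qed
  have xI': "x \<notin> I'" using x I'i(2) by blast
  have "insert x I' \<subseteq> ground M" using x X indep_ground[OF I'i(1)] by blast
  then obtain K where K: "insert x I \<subseteq> K" "maximal_in (indep M \<inter> Pow (insert x I')) K"
    using indep_extend[OF x(2), of "insert x I'"] I'(1) by blast
  have Ki: "K \<in> indep M" "K \<subseteq> insert x I'" using maximal_inD(1)[OF K(2)] by auto
  have Km: "maximal_in (indep M) K"
  proof (rule ccontr)
    assume "\<not> maximal_in (indep M) K"
    then obtain e where e: "e \<in> I' - K" "insert e K \<in> indep M" using indep_exchange[OF Ki(1) _ I'm] by blast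
    then have "insert e K = K" using maximal_inD(2)[OF K(2), of "insert e K"] Ki(2) by blast
    then show False using e by blast
  qed
  have "\<not> I' \<subseteq> K"
  proof
    assume "I' \<subseteq> K"
    then have "K = I'" using maximal_inD(2)[OF I'm Ki(1)] by blast
    then show False using K(1) xI' by blast
  qed
  then obtain b where b: "b \<in> I'" "b \<notin> K" by blast
  have bB: "b \<in> B - X" using b K(1) I'i(2) by blast
  have Bb: "B - {b} \<in> indep M" by (rule indep_subset[OF Bi]) blast
  have "\<not> maximal_in (indep M) (B - {b})" using maximal_inD(2)[of "indep M" "B - {b}" B] Bi bB by blast
  then obtain e where e: "e \<in> K - (B - {b})" "insert e (B - {b}) \<in> indep M"
    using indep_exchange[OF Bb _ Km] by blast
  have "e \<noteq> b" using e b by blast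
  then have eX: "e \<in> X" "e \<notin> B" using e Ki(2) I'i(2) x I by auto
  have "insert e J \<in> indep M" by (rule indep_subset[OF e(2)]) (use B(1) bB Ji(2) in blast)
  then have "insert e J = J" using maximal_inD(2)[OF J, of "insert e J"] eX Ji(2) by blast
  then show False using eX B(1) by blast
qed

text \<open>By \<open>restrict_exchange\<close>, one maximal independent subset decides membership
  in the closure, whichever independent set the definition uses.\<close>

lemma closure_maximal:
  assumes X: "X \<subseteq> ground M" and J: "maximal_in (indep M \<inter> Pow X) J" and x: "x \<in> ground M"
  shows "x \<in> matroid_closure M X \<longleftrightarrow> x \<in> J \<or> insert x J \<notin> indep M"
proof
  have Ji: "J \<in> indep M" "J \<subseteq> X" using maximal_inD(1)[OF J] by auto
  show "x \<in> matroid_closure M X" if "x \<in> J \<or> insert x J \<notin> indep M"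
    using that x Ji by (auto simp: matroid_closure_def)
  assume c: "x \<in> matroid_closure M X"
  show "x \<in> J \<or> insert x J \<notin> indep M"
  proof (cases "x \<in> X")
    case True
    have "insert x J = J" if "insert x J \<in> indep M"
      using maximal_inD(2)[OF J, of "insert x J"] that True Ji(2) by blast
    then show ?thesis by blast
  next
    case False
    then obtain I where I: "I \<subseteq> X" "I \<in> indep M" "insert x I \<notin> indep M" using c x by (auto simp: matroid_closure_def)
    obtain I' where I': "I \<subseteq> I'" "maximal_in (indep M \<inter> Pow X) I'" by (rule indep_extend[OF I(2,1) X])
    have I'm: "maximal_in (indep M \<inter> Pow (insert x X)) I'"
    proof (rule maximal_inI)
      show "I' \<in> indep M \<inter> Pow (insert x X)" using maximal_inD(1)[OF I'(2)] by blast
      fix Y assume Y: "Y \<in> indep M \<inter> Pow (insert x X)" "I' \<subseteq> Y"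
      have "x \<notin> Y" using indep_subset[of Y "insert x I"] Y I I' by blast
      then have "Y \<in> indep M \<inter> Pow X" using Y by blast
      then show "Y = I'" using maximal_inD(2)[OF I'(2)] Y by blast
    qed
    show ?thesis
    proof (rule ccontr)
      assume n: "\<not> ?thesis"
      have "insert x X \<subseteq> ground M" using x X by blast
      then obtain e where e: "e \<in> I' - J" "insert e J \<in> indep M"
        using restrict_exchange[OF _ I'm, of J x] n Ji by blast
      have "e \<in> X" using e maximal_inD(1)[OF I'(2)] by blast
      then have "insert e J = J" using maximal_inD(2)[OF J, of "insert e J"] e Ji by blast
      then show False using e by blast
    qed
  qed
qed

lemma closure_Int_ground: "matroid_closure M (X \<inter> ground M) = matroid_closure M X"
proof -
  have "I \<subseteq> X \<inter> ground M \<longleftrightarrow> I \<subseteq> X" if "I \<in> indep M" for I using indep_ground[OF that] by blast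
  then show ?thesis unfolding matroid_closure_def by blast
qed

lemma closure_outside: "- ground M \<subseteq> matroid_closure M X"
  by (auto simp: matroid_closure_def)

lemma maximal_exists:
  obtains J where "maximal_in (indep M \<inter> Pow (X \<inter> ground M)) J"
  using indep_extend[OF indep_empty, of "X \<inter> ground M"] by blast

lemma closure_ext: "X \<subseteq> matroid_closure M X"
  by (auto simp: matroid_closure_def)

lemma closure_mono: "X \<subseteq> Y \<Longrightarrow> matroid_closure M X \<subseteq> matroid_closure M Y"
  unfolding matroid_closure_def by blast

text \<open>A maximal independent subset of \<open>X\<close> stays maximal within the closure, so it
  determines both closures.\<close>

lemma closure_idem: "matroid_closure M (matroid_closure M X) \<subseteq> matroid_closure M X"
proof
  fix x assume x: "x \<in> matroid_closure M (matroid_closure M X)"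
  obtain J where J: "maximal_in (indep M \<inter> Pow (X \<inter> ground M)) J" by (rule maximal_exists)
  note cl = closure_maximal[OF Int_lower2 J, unfolded closure_Int_ground]
  have Ji: "J \<in> indep M" "J \<subseteq> X \<inter> ground M" using maximal_inD(1)[OF J] by auto
  have J2: "maximal_in (indep M \<inter> Pow (matroid_closure M X \<inter> ground M)) J"
  proof (rule maximal_inI)
    show "J \<in> indep M \<inter> Pow (matroid_closure M X \<inter> ground M)" using Ji closure_ext[of X] by blast
    fix Y assume Y: "Y \<in> indep M \<inter> Pow (matroid_closure M X \<inter> ground M)" "J \<subseteq> Y"
    have "y \<in> J" if y: "y \<in> Y" for y
    proof -
      have "y \<in> matroid_closure M X" "y \<in> ground M" using Y y by auto
      then have "y \<in> J \<or> insert y J \<notin> indep M" using cl by blast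
      then show ?thesis using indep_subset[of Y "insert y J"] Y y by blast
    qed
    then show "Y = J" using Y by blast
  qed
  show "x \<in> matroid_closure M X"
  proof (cases "x \<in> ground M")
    case True
    then show ?thesis using x cl[of x] closure_maximal[OF Int_lower2 J2, unfolded closure_Int_ground, of x] by blast
  qed (use closure_outside in blast)
qed

lemma closure_exchange:
  assumes y: "y \<in> matroid_closure M (insert x X)" "y \<notin> matroid_closure M X" shows "x \<in> matroid_closure M (insert y X)"
proof (cases "x \<in> ground M \<and> y \<noteq> x")
  case False
  then show ?thesis using closure_outside[of "insert y X"] closure_ext[of "insert y X"] by blast
next
  case True
  have yg: "y \<in> ground M" using y(2) closure_outside by blast
  have "x \<notin> matroid_closure M X"
  proof
    assume "x \<in> matroid_closure M X"
    then have "matroid_closure M (insert x X) \<subseteq> matroid_closure M (matroid_closure M X)" using closure_ext[of X] by (intro closure_mono) blast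
    then show False using y closure_idem[of X] by blast
  qed
  obtain J where J: "maximal_in (indep M \<inter> Pow (X \<inter> ground M)) J" by (rule maximal_exists)
  note cl = closure_maximal[OF Int_lower2 J, unfolded closure_Int_ground]
  have Ji: "J \<in> indep M" "J \<subseteq> X \<inter> ground M" using maximal_inD(1)[OF J] by auto
  have xJ: "insert x J \<in> indep M" "x \<notin> J" using cl[of x] True \<open>x \<notin> matroid_closure M X\<close> by blast+
  have yJ: "insert y J \<in> indep M" "y \<notin> J" using cl[of y] yg y by blast+
  have J2: "maximal_in (indep M \<inter> Pow (insert x X \<inter> ground M)) (insert x J)"
  proof (rule maximal_inI)
    show "insert x J \<in> indep M \<inter> Pow (insert x X \<inter> ground M)" using xJ Ji True by blast
    fix Y assume Y: "Y \<in> indep M \<inter> Pow (insert x X \<inter> ground M)" "insert x J \<subseteq> Y"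
    have "Y - {x} \<in> indep M" by (rule indep_subset[of Y]) (use Y in auto)
    then have "Y - {x} = J" using maximal_inD(2)[OF J, of "Y - {x}"] Y xJ(2) by blast
    then show "Y = insert x J" using Y by blast
  qed
  have "y \<in> insert x J \<or> insert y (insert x J) \<notin> indep M"
    using closure_maximal[OF Int_lower2 J2 yg, unfolded closure_Int_ground] y(1) by blast
  then have "insert x (insert y J) \<notin> indep M" using True yJ by (auto simp: insert_commute)
  moreover have "insert y J \<subseteq> insert y X" using Ji by blast
  ultimately show ?thesis using True yJ(1) unfolding matroid_closure_def by blast
qed

lemma cl_indep_closure: "cl_indep (matroid_closure M) I \<longleftrightarrow> I \<in> indep M"
proof
  assume I: "I \<in> indep M"
  have "x \<notin> matroid_closure M (I - {x})" if x: "x \<in> I" for x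
  proof
    assume c: "x \<in> matroid_closure M (I - {x})"
    have Ig: "I \<subseteq> ground M" by (rule indep_ground[OF I])
    have "I - {x} \<in> indep M" by (rule indep_subset[OF I]) blast
    then have "maximal_in (indep M \<inter> Pow (I - {x})) (I - {x})" by (intro maximal_inI) auto
    then have "insert x (I - {x}) \<notin> indep M"
      using closure_maximal[of "I - {x}" "I - {x}" x] c Ig x by blast
    then show False using I x by (simp add: insert_absorb)
  qed
  then show "cl_indep (matroid_closure M) I" by (simp add: cl_indep_def)
next
  assume I: "cl_indep (matroid_closure M) I"
  then have Ig: "I \<subseteq> ground M" using closure_outside unfolding cl_indep_def by blast
  obtain J where J: "maximal_in (indep M \<inter> Pow (I \<inter> ground M)) J" by (rule maximal_exists)
  have Ji: "J \<in> indep M" "J \<subseteq> I" using maximal_inD(1)[OF J] by auto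
  have "x \<in> J" if x: "x \<in> I" for x
  proof (rule ccontr)
    assume n: "x \<notin> J"
    have "insert x J \<notin> indep M"
      using maximal_inD(2)[OF J, of "insert x J"] n x Ji Ig by blast
    then have "x \<in> matroid_closure M J" using Ji x Ig by (auto simp: matroid_closure_def)
    moreover have "matroid_closure M J \<subseteq> matroid_closure M (I - {x})" by (rule closure_mono) (use Ji n in blast)
    ultimately show False using I x by (auto simp: cl_indep_def)
  qed
  then show "I \<in> indep M" using Ji by (metis subsetI subset_antisym)
qed

sublocale closure_matroid "matroid_closure M"
proof
  show "X \<subseteq> Y \<Longrightarrow> matroid_closure M X \<subseteq> matroid_closure M Y" for X Y by (rule closure_mono)
  fix I X assume I: "cl_indep (matroid_closure M) I" "I \<subseteq> X"
  then have Ii: "I \<in> indep M" by (simp add: cl_indep_closure)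
  obtain B where B: "I \<subseteq> B" "maximal_in (indep M \<inter> Pow (X \<inter> ground M)) B"
    using indep_extend[OF Ii, of "X \<inter> ground M"] I indep_ground[OF Ii] by blast
  have Bi: "B \<in> indep M" "B \<subseteq> X" using maximal_inD(1)[OF B(2)] by auto
  have "x \<in> matroid_closure M B" if x: "x \<in> X" for x
  proof (cases "x \<in> ground M")
    case True
    then have "x \<in> B \<or> insert x B \<notin> indep M"
      using maximal_inD(2)[OF B(2), of "insert x B"] x Bi maximal_inD(1)[OF B(2)] by blast
    then show ?thesis using True Bi by (auto simp: matroid_closure_def)
  qed (use closure_outside in blast)
  then show "\<exists>B. I \<subseteq> B \<and> B \<subseteq> X \<and> cl_indep (matroid_closure M) B \<and> X \<subseteq> matroid_closure M B"
    using B Bi cl_indep_closure[of B] by blast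
qed (use closure_ext closure_idem closure_exchange in auto)

section \<open>Bases, duals and contractions in terms of closures\<close>

lemma base_iff: "base M B \<longleftrightarrow> cl_indep (matroid_closure M) B \<and> matroid_closure M B = UNIV"
proof -
  have "indep M = {B. B \<subseteq> UNIV \<and> cl_indep (matroid_closure M) B}" by (auto simp: cl_indep_closure)
  then show ?thesis
    unfolding base_def using maximal_in_iff[of UNIV B] by (auto simp: top_unique)
qed

lemma base_restrict_iff:
  "base (restrict_to M W) B \<longleftrightarrow> B \<subseteq> W \<and> cl_indep (matroid_closure M) B \<and> W \<subseteq> matroid_closure M B"
proof -
  have "indep (restrict_to M W) = {B. B \<subseteq> W \<and> cl_indep (matroid_closure M) B}" by (auto simp: restrict_to_def cl_indep_closure)
  then show ?thesis unfolding base_def by (simp add: maximal_in_iff)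
qed

lemma indep_dual: "I \<in> indep (dual M) \<longleftrightarrow> I \<subseteq> ground M \<and> cl_indep (cl_dual (matroid_closure M)) I"
proof -
  have "(\<exists>B. base M B \<and> I \<subseteq> ground M - B) \<longleftrightarrow> I \<subseteq> ground M \<and> matroid_closure M (- I) = UNIV"
  proof
    assume "\<exists>B. base M B \<and> I \<subseteq> ground M - B"
    then obtain B where B: "matroid_closure M B = UNIV" "I \<subseteq> ground M - B" by (auto simp: base_iff)
    then show "I \<subseteq> ground M \<and> matroid_closure M (- I) = UNIV" using closure_mono[of B "- I"] by blast
  next
    assume I: "I \<subseteq> ground M \<and> matroid_closure M (- I) = UNIV"
    obtain B where B: "B \<subseteq> - I" "cl_indep (matroid_closure M) B" "- I \<subseteq> matroid_closure M B" using basis by blast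
    then have "base M B" using le[OF B(3)] I by (auto simp: base_iff)
    then show "\<exists>B. base M B \<and> I \<subseteq> ground M - B" using B I by blast
  qed
  then show ?thesis by (simp add: dual_def cl_indep_dual)
qed

lemma cl_finitary_closure:
  assumes "finitary M" shows "cl_finitary (matroid_closure M)"
proof (rule cl_finitary_circuits)
  fix C assume C: "\<not> cl_indep (matroid_closure M) C" "\<And>Y. Y \<subset> C \<Longrightarrow> cl_indep (matroid_closure M) Y"
  have min: "Y = C" if "\<not> cl_indep (matroid_closure M) Y" "Y \<subseteq> C" for Y using C(2)[of Y] that by blast
  show "finite C"
  proof (cases "C \<subseteq> ground M")
    case True
    then have "circuit M C" unfolding circuit_def minimal_in_def
      using C(1) min by (simp add: cl_indep_closure[symmetric])
    then show ?thesis using assms by (simp add: finitary_def)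
  next
    case False
    then obtain x where x: "x \<in> C" "x \<notin> ground M" by blast
    then have "\<not> cl_indep (matroid_closure M) {x}" using closure_outside by (auto simp: cl_indep_def)
    then have "C = {x}" using C(2)[of "{x}"] x by blast
    then show ?thesis by simp
  qed
qed

text \<open>Elements outside the ground set are coloops of \<open>cl_dual\<close> and lie in no
  minimal dependent set, so all such sets are circuits of the dual matroid.\<close>

lemma cl_finitary_dual_closure:
  assumes "cofinitary M" shows "cl_finitary (cl_dual (matroid_closure M))"
proof (rule closure_matroid.cl_finitary_circuits[OF closure_matroid_dual])
  fix C assume C: "\<not> cl_indep (cl_dual (matroid_closure M)) C" "\<And>Y. Y \<subset> C \<Longrightarrow> cl_indep (cl_dual (matroid_closure M)) Y"
  have "C \<subseteq> ground M"
  proof (rule ccontr)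
    assume "\<not> C \<subseteq> ground M"
    then obtain x where x: "x \<in> C" "x \<notin> ground M" by blast
    have "matroid_closure M (- (C - {x})) = UNIV" using C(2)[of "C - {x}"] x by (auto simp: cl_indep_dual)
    moreover have "- (C - {x}) = insert x (- C)" using x by blast
    moreover have "x \<in> matroid_closure M (- C)" using x closure_outside by blast
    ultimately have "matroid_closure M (- C) = UNIV" using span_insert by simp
    then show False using C(1) by (simp add: cl_indep_dual)
  qed
  moreover have "Y = C" if "\<not> cl_indep (cl_dual (matroid_closure M)) Y" "Y \<subseteq> C" for Y using C(2)[of Y] that by blast
  moreover have "ground (Defs.dual M) = ground M" by (simp add: Defs.dual_def)
  ultimately have "circuit (Defs.dual M) C" unfolding circuit_def minimal_in_def
    using C(1) by (simp add: indep_dual)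
  then show "finite C" using assms by (simp add: cofinitary_def finitary_def)
qed

text \<open>Contraction is defined by dualising twice: its bases are the sets \<open>W - D\<close>
  for dual bases \<open>D\<close> of \<open>W\<close>. Complements within \<open>W\<close> match
  these with the bases of \<open>W\<close> over \<open>- W\<close>.\<close>

lemma indep_contract_onto:
  assumes W: "W \<subseteq> ground M"
  shows "B \<in> indep (contract_onto M W) \<longleftrightarrow> B \<subseteq> W \<and> cl_indep (cl_contract (matroid_closure M) (- W)) B"
proof -
  interpret dual: closure_matroid "cl_dual (matroid_closure M)" by (rule closure_matroid_dual)
  have gd: "ground (dual M) = ground M" by (simp add: dual_def)
  have "delete (dual M) (ground M - W) = restrict_to (dual M) W"
    using W by (simp add: delete_def gd double_diff)
  then have eq: "contract_onto M W = Defs.dual (restrict_to (Defs.dual M) W)"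
    by (simp add: contract_onto_def contract_def)
  have "indep (restrict_to (Defs.dual M) W) = {D. D \<subseteq> W \<and> cl_indep (cl_dual (matroid_closure M)) D}"
    using W by (auto simp: restrict_to_def indep_dual)
  then have base: "base (restrict_to (Defs.dual M) W) D \<longleftrightarrow>
      D \<subseteq> W \<and> cl_indep (cl_dual (matroid_closure M)) D \<and> W \<subseteq> cl_dual (matroid_closure M) D" for D
    unfolding base_def by (simp add: closure_matroid.maximal_in_iff[OF closure_matroid_dual])
  have "B \<in> indep (contract_onto M W) \<longleftrightarrow> (\<exists>D. D \<subseteq> W \<and> cl_indep (cl_dual (matroid_closure M)) D \<and> W \<subseteq> cl_dual (matroid_closure M) D \<and> B \<subseteq> W - D)"
    unfolding eq Defs.dual_def[of "restrict_to (Defs.dual M) W"] by (simp add: base) (simp add: restrict_to_def)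
  also have "\<dots> \<longleftrightarrow> B \<subseteq> W \<and> cl_indep (cl_contract (matroid_closure M) (- W)) B"
  proof
    assume "\<exists>D. D \<subseteq> W \<and> cl_indep (cl_dual (matroid_closure M)) D \<and> W \<subseteq> cl_dual (matroid_closure M) D \<and> B \<subseteq> W - D"
    then obtain D where D: "D \<subseteq> W" "W \<subseteq> cl_dual (matroid_closure M) D" "B \<subseteq> W - D" by blast
    have "b \<notin> matroid_closure M (B - {b} \<union> - W)" if b: "b \<in> B" for b
    proof -
      have "b \<in> cl_dual (matroid_closure M) D" "b \<notin> D" using D b by auto
      then have "b \<notin> matroid_closure M (- D - {b})" unfolding cl_dual_def by blast
      moreover have "matroid_closure M (B - {b} \<union> - W) \<subseteq> matroid_closure M (- D - {b})" by (rule closure_mono) (use D b in blast)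
      ultimately show ?thesis by blast
    qed
    then show "B \<subseteq> W \<and> cl_indep (cl_contract (matroid_closure M) (- W)) B" using D by (auto simp: cl_indep_def cl_contract_def)
  next
    assume B: "B \<subseteq> W \<and> cl_indep (cl_contract (matroid_closure M) (- W)) B"
    obtain K where K: "B \<subseteq> K" "K \<subseteq> W" "cl_indep (cl_contract (matroid_closure M) (- W)) K" "W \<subseteq> cl_contract (matroid_closure M) (- W) K"
      using closure_matroid.extend[OF closure_matroid_contract conjunct2[OF B] conjunct1[OF B]] by (elim exE conjE) (rule that)
    have 1: "W \<subseteq> cl_dual (matroid_closure M) (W - K)"
    proof
      fix b assume b: "b \<in> W"
      show "b \<in> cl_dual (matroid_closure M) (W - K)"
      proof (cases "b \<in> K")
        case True
        then have "b \<notin> matroid_closure M (K - {b} \<union> - W)" using K by (simp add: cl_indep_def cl_contract_def)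
        moreover have "K - {b} \<union> - W = - (W - K) - {b}" using True K by blast
        ultimately have "b \<notin> matroid_closure M (- (W - K) - {b})" by (simp only: not_False_eq_True)
        then show ?thesis unfolding cl_dual_def by blast
      qed (use b dual.ext in blast)
    qed
    have "- (W - K) = K \<union> - W" using K by blast
    then have "matroid_closure M (- (W - K)) = UNIV" using K(4) ext[of "K \<union> - W"] by (auto simp: cl_contract_def)
    then have "cl_indep (cl_dual (matroid_closure M)) (W - K)" by (simp add: cl_indep_dual)
    then show "\<exists>D. D \<subseteq> W \<and> cl_indep (cl_dual (matroid_closure M)) D \<and> W \<subseteq> cl_dual (matroid_closure M) D \<and> B \<subseteq> W - D"
      using 1 B K by (intro exI[of _ "W - K"]) blast
  qed
  finally show ?thesis .
qed

lemma base_contract_onto: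
  assumes W: "W \<subseteq> ground M"
  shows "base (contract_onto M W) B \<longleftrightarrow> B \<subseteq> W \<and> cl_indep (cl_contract (matroid_closure M) (- W)) B \<and> W \<subseteq> matroid_closure M (B \<union> - W)"
proof -
  have "indep (contract_onto M W) = {B. B \<subseteq> W \<and> cl_indep (cl_contract (matroid_closure M) (- W)) B}"
    using indep_contract_onto[OF W] by blast
  then show ?thesis unfolding base_def by (simp add: closure_matroid.maximal_in_iff[OF closure_matroid_contract] cl_contract_def)
qed

end

section \<open>Common bases and the two conditions\<close>

lemma common_base_imp_cond:
  assumes "matroid M" "matroid N" "ground M = ground N" and K: "base M K" "base N K"
  shows "matroid_cond M N"
proof -
  interpret M: infinite_matroid M by unfold_locales fact
  interpret N: infinite_matroid N by unfold_locales fact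
  have "\<exists>B. base (contract_onto N W) B \<and> B \<in> indep (restrict_to M W)" if "W \<subseteq> ground M" for W
  proof -
    have W: "W \<subseteq> ground N" using that assms by simp
    interpret C: closure_matroid "cl_contract (matroid_closure N) (- W)" by (rule N.closure_matroid_contract)
    \<comment> \<open>The trace of \<open>K\<close> on \<open>W\<close> spans in the contraction of
      \<open>N\<close> onto \<open>W\<close>. Thinned to a basis there, it remains independent in
      \<open>M\<close> as a subset of \<open>K\<close>.\<close>
    obtain B where B: "B \<subseteq> K \<inter> W" "cl_indep (cl_contract (matroid_closure N) (- W)) B" "K \<inter> W \<subseteq> cl_contract (matroid_closure N) (- W) B"
      using C.basis by blast
    have "K \<subseteq> matroid_closure N (B \<union> - W)" using B(3) N.ext[of "B \<union> - W"] by (auto simp: cl_contract_def)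
    then have "matroid_closure N (B \<union> - W) = UNIV" using N.le[of K] K(2) by (auto simp: N.base_iff)
    then have "base (contract_onto N W) B" using B by (auto simp: N.base_contract_onto[OF W])
    moreover have "B \<in> indep M" using K(1) B(1) M.cl_indep_subset[of K B] by (auto simp: M.base_iff M.cl_indep_closure)
    ultimately show ?thesis using B(1) by (auto simp: restrict_to_def)
  qed
  then show ?thesis by (simp add: matroid_cond_def)
qed

text \<open>To apply the condition to a wave of the closure operators, elements outside the ground
  set are dropped, being loops, and the witness is thinned to a base in \<open>M\<close>. As the
  common loops get decided at the start, all undecided elements belong to the countable ground
  set.\<close>

lemma cond_imp_indep_spanning:
  assumes M: "matroid M" "finitary M \<or> cofinitary M" and N: "matroid N" "finitary N \<or> cofinitary N"
    and g: "ground M = ground N" "countable (ground N)" and cond: "matroid_cond M N"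
  shows "\<exists>I. cl_indep (matroid_closure M) I \<and> matroid_closure N I = UNIV"
proof -
  interpret M: infinite_matroid M by unfold_locales fact
  interpret N: infinite_matroid N by unfold_locales fact
  interpret P: closure_matroid_pair "matroid_closure M" "matroid_closure N" by (intro closure_matroid_pair.intro M.closure_matroid_axioms N.closure_matroid_axioms)
  have "\<exists>K \<subseteq> W. cl_indep (matroid_closure M) K \<and> W \<subseteq> matroid_closure N (K \<union> - W)" if w: "rel_wave (matroid_closure M) (matroid_closure N) {} W B" for W B
  proof -
    define V where "V = W \<inter> ground N"
    have BW: "B \<subseteq> W" and WM: "W \<subseteq> matroid_closure M B" and iB: "cl_indep (cl_contract (matroid_closure N) (- W)) B"
      using w by (auto simp: rel_wave_def)
    have VM: "V \<subseteq> ground M" and VN: "V \<subseteq> ground N" using g by (auto simp: V_def)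
    have VW: "- V \<subseteq> matroid_closure N (- W)" using N.closure_outside N.ext[of "- W"] by (auto simp: V_def)
    obtain B' where B': "B' \<subseteq> B" "cl_indep (matroid_closure M) B'" "B \<subseteq> matroid_closure M B'" using M.basis by blast
    have BV: "B \<subseteq> V" using BW N.cl_indep_contract_disj[OF iB] N.closure_outside[of "- W"] by (auto simp: V_def)
    have "cl_indep (cl_contract (matroid_closure N) (- V)) B" by (rule N.cl_indep_contract_mono[OF iB VW])
    then have "cl_indep (cl_contract (matroid_closure N) (- V)) B'" using closure_matroid.cl_indep_subset[OF N.closure_matroid_contract _ B'(1)] by blast
    then have "B' \<in> indep (contract_onto N V)" using B'(1) BV by (simp add: N.indep_contract_onto[OF VN])
    moreover have "V \<subseteq> matroid_closure M B'" using WM M.le[OF B'(3)] by (auto simp: V_def)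
    then have "base (restrict_to M V) B'" using B' BV by (auto simp: M.base_restrict_iff)
    ultimately obtain K where K: "base (contract_onto N V) K" "K \<in> indep (restrict_to M V)"
      using cond VM unfolding matroid_cond_def by blast
    have KV: "K \<subseteq> V" and VK: "V \<subseteq> matroid_closure N (K \<union> - V)" using K(1) by (auto simp: N.base_contract_onto[OF VN])
    have "K \<union> - V \<subseteq> matroid_closure N (K \<union> - W)"
      using VW N.mono[of "- W" "K \<union> - W"] N.ext[of "K \<union> - W"] by blast
    then have "V \<subseteq> matroid_closure N (K \<union> - W)" using VK N.le by blast
    then have "W \<subseteq> matroid_closure N (K \<union> - W)" using N.closure_outside[of "K \<union> - W"] by (auto simp: V_def)
    moreover have "cl_indep (matroid_closure M) K" using K(2) by (simp add: restrict_to_def M.cl_indep_closure)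
    ultimately show ?thesis using KV by (intro exI[of _ K]) (auto simp: V_def)
  qed
  then obtain I J where IJ: "wave_free (matroid_closure M) (matroid_closure N) I J" "matroid_closure M {} \<inter> matroid_closure N {} \<subseteq> I \<union> J"
    using P.initial_wave_free by metis
  have "- (I \<union> J) \<subseteq> ground N" using IJ(2) M.closure_outside[of "{}"] N.closure_outside[of "{}"] g by blast
  then have "countable (- (I \<union> J))" using g(2) by (rule countable_subset)
  then show ?thesis
    using P.wave_free_limit[OF IJ(1)] M(2) N(2) M.cl_finitary_closure M.cl_finitary_dual_closure N.cl_finitary_closure N.cl_finitary_dual_closure
    by blast
qed

theorem theorem1p6:
  fixes M N :: "'a matroid" and E :: "'a set"
  assumes "matroid M" and "matroid N"
    and "ground M = E" and "ground N = E"
    and "countable E"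
    and "finitary M \<or> cofinitary M"
    and "finitary N \<or> cofinitary N"
  shows "(\<exists>B. base M B \<and> base N B) \<longleftrightarrow> matroid_cond M N \<and> matroid_cond N M"
proof
  assume "\<exists>B. base M B \<and> base N B"
  then show "matroid_cond M N \<and> matroid_cond N M"
    using common_base_imp_cond[of M N] common_base_imp_cond[of N M] assms by auto
next
  assume cond: "matroid_cond M N \<and> matroid_cond N M"
  interpret M: infinite_matroid M by unfold_locales fact
  interpret N: infinite_matroid N by unfold_locales fact
  interpret P: closure_matroid_pair "matroid_closure M" "matroid_closure N" by (intro closure_matroid_pair.intro M.closure_matroid_axioms N.closure_matroid_axioms)
  obtain I where I: "cl_indep (matroid_closure M) I" "matroid_closure N I = UNIV"
    using cond_imp_indep_spanning[of M N] assms cond by auto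
  obtain J where J: "cl_indep (matroid_closure N) J" "matroid_closure M J = UNIV"
    using cond_imp_indep_spanning[of N M] assms cond by auto
  have "cl_finitary (matroid_closure M) \<or> cl_finitary (cl_dual (matroid_closure M))" "cl_finitary (matroid_closure N) \<or> cl_finitary (cl_dual (matroid_closure N))"
    using assms M.cl_finitary_closure M.cl_finitary_dual_closure N.cl_finitary_closure N.cl_finitary_dual_closure by blast+
  then show "\<exists>B. base M B \<and> base N B"
    using P.common_basis[OF _ _ I J] by (auto simp: M.base_iff N.base_iff)
qed

end
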